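(* Let $d \ge 2$, let $\mu$ be an infinitely divisible probability measure on $\mathbb{R}$ that is not a point mass, and let $\Pi$ be a Lévy noise on $\mathbb{R}^d$ corresponding to $\mu$, defined on a probability space $(\Omega, \mathcal{F}, \mathbb{P})$. Let $\Gamma$ be the group of linear maps $\mathbb{R}^d \to \mathbb{R}^d$ whose determinant has absolute value $1$, and let $G$ be a closed subgroup of $\Gamma$. Then the invariant $\sigma$-field $\mathcal{I}_G$ consists of sets with probability $0$ or $1$ (that is, $\mathbb{P}\{\Pi \in S\} \in \{0,1\}$ for every $S \in \mathcal{I}_G$) if and only if $G$ is not compact.
   Context: Convolution semigroup: for an infinitely divisible probability measure $\mu$ on $\mathbb{R}$, $(\mu_t)_{t \ge 0}$ denotes the associated convolution semigroup of probability measures on $\mathbb{R}$: $\mu_1 = \mu$, $\mu_0 = \delta_0$, $\mu_s * \mu_t = \mu_{s+t}$ for all $s,t \ge 0$, and $\mu_t \to \mu_s$ weakly as $t \downarrow s$ for all $s \ge 0$. Notation: $\mathcal{B}(\mathbb{R}^d)$ is the Borel $\sigma$-field of $\mathbb{R}^d$, $\Lambda$ is Lebesgue measure on $\mathbb{R}^d$, and $\mathcal{C}(\mathbb{R}^d)$ is the collection of $B \in \mathcal{B}(\mathbb{R}^d)$ with $\Lambda(B) < \infty$. Lévy noise: a Lévy noise on $\mathbb{R}^d$ corresponding to $\mu$ is a collection of real-valued random variables $\Pi = \{\Pi(B) : B \in \mathcal{C}(\mathbb{R}^d)\}$ on a probability space $(\Omega, \mathcal{F}, \mathbb{P})$ such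 that (i) $\Pi(B)$ has distribution $\mu_{\Lambda(B)}$ for all $B \in \mathcal{C}(\mathbb{R}^d)$; (ii) if $B_1, \ldots, B_n$ is a finite collection of pairwise disjoint sets in $\mathcal{C}(\mathbb{R}^d)$, then $\Pi(B_1), \ldots, \Pi(B_n)$ are independent and $\Pi(B_1 \cup \cdots \cup B_n) = \Pi(B_1) + \cdots + \Pi(B_n)$ almost surely. Invariant $\sigma$-field: let $\Sigma = \mathbb{R}^{\mathcal{C}(\mathbb{R}^d)}$ with product $\sigma$-field $\mathcal{S}$; $\Pi$ is regarded as a measurable map $(\Omega,\mathcal{F}) \to (\Sigma, \mathcal{S})$. For a Lebesgue measure preserving Borel bijection $g$ of $\mathbb{R}^d$ with Borel inverse, $T_g : \Sigma \to \Sigma$ is the bijection sending $(\pi(B))_{B \in \mathcal{C}(\mathbb{R}^d)}$ to $(\pi(g^{-1}B))_{B \in \mathcal{C}(\mathbb{R}^d)}$. For a group $G$ of such bijections, $\mathcal{I}_G$ is the collection of sets $S \in \mathcal{S}$ such that $\mathbb{P}(\{\Pi \in S\} \triangle \{T_g \Pi \in S\}) = 0$ for all $g \in G$, where $\triangle$ denotes symmetric difference. $\Gamma$ is identified with a group of real $d \times d$ matrices and carries the usual topology; its elements are exactly the linear maps of $\mathbb{R}^d$ that preserve Lebesgue measure. *)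

theory Defs
  imports "HOL-Probability.Probability" "HOL-Algebra.Group"
begin

section \<open>Infinitely divisible laws and convolution semigroups\<close>

primrec convolution_power :: "real measure \<Rightarrow> nat \<Rightarrow> real measure" where
  "convolution_power \<nu> 0 = return borel 0"
| "convolution_power \<nu> (Suc n) = (convolution_power \<nu> n \<star> \<nu>)"

definition infinitely_divisible :: "real measure \<Rightarrow> bool" where
  "infinitely_divisible \<mu> \<longleftrightarrow> real_distribution \<mu> \<and>
     (\<forall>n\<ge>1. \<exists>\<nu>. real_distribution \<nu> \<and> convolution_power \<nu> n = \<mu>)"

text \<open>Only the values at times \<open>t \<ge> 0\<close> are constrained. The library's weak convergence of
  probability measures on the line is sequential, so convergence as \<open>t\<close> decreases to \<open>s\<close> is
  expressed along all sequences that approach \<open>s\<close> strictly from the right.\<close>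

definition convolution_semigroup :: "real measure \<Rightarrow> (real \<Rightarrow> real measure) \<Rightarrow> bool" where
  "convolution_semigroup \<mu> \<mu>t \<longleftrightarrow>
     (\<forall>t\<ge>0. real_distribution (\<mu>t t)) \<and>
     \<mu>t 1 = \<mu> \<and>
     \<mu>t 0 = return borel 0 \<and>
     (\<forall>s\<ge>0. \<forall>t\<ge>0. (\<mu>t s \<star> \<mu>t t) = \<mu>t (s + t)) \<and>
     (\<forall>s\<ge>0. \<forall>r. filterlim r (at_right s) sequentially \<longrightarrow>
        weak_conv_m (\<lambda>n. \<mu>t (r n)) (\<mu>t s))"

section \<open>Levy noise\<close>

definition finite_borel :: "'a::euclidean_space set set" where
  "finite_borel = {B \<in> sets borel. emeasure lborel B < \<infinity>}"

text \<open>The convolution semigroup of an infinitely divisible law exists and is unique on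
  \<open>t \<ge> 0\<close>, so the existential quantifier below selects the semigroup associated with \<open>\<mu>\<close>.
  The values of \<open>\<Xi>\<close> outside \<^const>\<open>finite_borel\<close> are irrelevant.\<close>

definition levy_noise ::
  "'w measure \<Rightarrow> real measure \<Rightarrow> ('a::euclidean_space set \<Rightarrow> 'w \<Rightarrow> real) \<Rightarrow> bool" where
  "levy_noise P \<mu> \<Xi> \<longleftrightarrow> prob_space P \<and>
     (\<forall>B\<in>finite_borel. \<Xi> B \<in> borel_measurable P) \<and>
     (\<exists>\<mu>t. convolution_semigroup \<mu> \<mu>t \<and>
        (\<forall>B\<in>finite_borel. distr P borel (\<Xi> B) = \<mu>t (measure lborel B))) \<and>
     (\<forall>(n::nat) B. B ` {..<n} \<subseteq> finite_borel \<and> disjoint_family_on B {..<n} \<longrightarrow>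
        prob_space.indep_vars P (\<lambda>_. borel) (\<lambda>i. \<Xi> (B i)) {..<n} \<and>
        (AE \<omega> in P. \<Xi> (\<Union>i<n. B i) \<omega> = (\<Sum>i<n. \<Xi> (B i) \<omega>)))"

section \<open>The invariant sigma-field\<close>

definition noise_space :: "('a::euclidean_space set \<Rightarrow> real) measure" where
  "noise_space = PiM finite_borel (\<lambda>_. borel)"

definition noise_map ::
  "('a::euclidean_space set \<Rightarrow> 'w \<Rightarrow> real) \<Rightarrow> 'w \<Rightarrow> 'a set \<Rightarrow> real" where
  "noise_map \<Xi> \<omega> = (\<lambda>B\<in>finite_borel. \<Xi> B \<omega>)"

definition noise_shift ::
  "('a::euclidean_space \<Rightarrow> 'a) \<Rightarrow> ('a set \<Rightarrow> real) \<Rightarrow> 'a set \<Rightarrow> real" where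
  "noise_shift g \<pi> = (\<lambda>B\<in>finite_borel. \<pi> (g -` B))"

text \<open>Intended for a group \<open>H\<close> of Lebesgue measure preserving Borel bijections with Borel inverse.\<close>

definition invariant_sigma_field ::
  "'w measure \<Rightarrow> ('a::euclidean_space set \<Rightarrow> 'w \<Rightarrow> real) \<Rightarrow> ('a \<Rightarrow> 'a) set
     \<Rightarrow> ('a set \<Rightarrow> real) set set" where
  "invariant_sigma_field P \<Xi> H = {S \<in> sets noise_space. \<forall>g\<in>H.
     measure P (sym_diff {\<omega> \<in> space P. noise_map \<Xi> \<omega> \<in> S}
                         {\<omega> \<in> space P. noise_shift g (noise_map \<Xi> \<omega>) \<in> S}) = 0}"

section \<open>The group of Lebesgue measure preserving linear maps\<close>

definition unimodular_group :: "(real^'n^'n) monoid" where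
  "unimodular_group = \<lparr>carrier = {A. \<bar>det A\<bar> = 1}, mult = (**), one = mat 1\<rparr>"

lemma group_unimodular_group: "group (unimodular_group :: (real^'n^'n) monoid)"
proof (rule groupI)
  fix A :: "real^'n^'n"
  assume A: "A \<in> carrier unimodular_group"
  then have "invertible A"
    by (auto simp: unimodular_group_def invertible_det_nz)
  then obtain B where B: "B ** A = mat 1"
    by (auto simp: invertible_def)
  then have "det B * det A = 1"
    by (metis det_mul det_I)
  then have "\<bar>det B\<bar> * \<bar>det A\<bar> = 1"
    by (metis abs_mult abs_one)
  with A B show "\<exists>B\<in>carrier unimodular_group. B \<otimes>\<^bsub>unimodular_group\<^esub> A = \<one>\<^bsub>unimodular_group\<^esub>"
    by (auto simp: unimodular_group_def)
qed (auto simp: unimodular_group_def det_mul abs_mult matrix_mul_assoc)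

end

theory Submission
  imports Defs
begin

text \<open>
  If \<open>G\<close> is compact, the union of the \<open>G\<close>-translates of a ball, rescaled to volume 1, is a
  \<open>G\<close>-invariant set \<open>B\<close>; then \<open>\<Pi>(B)\<close> has the nondegenerate law \<open>\<mu>\<close>, and some event
  \<open>\<Pi>(B) \<le> a\<close> is invariant and nontrivial.

  If \<open>G\<close> is not compact, it is unbounded. A matrix with a large entry maps a ball onto a set that
  meets the ball only in the image of a thin slab, so there are \<open>g\<^sub>n \<in> G\<close> for which the ball of radius
  \<open>n\<close> and its preimage under \<open>g\<^sub>n\<close> overlap in volume less than \<open>2\<^sup>-\<^sup>n\<close>. By Borel--Cantelli every
  \<open>B\<close> of finite volume is, up to small volume, a bounded set that is disjoint from the preimage of
  the ball of radius \<open>n\<close> for all large \<open>n\<close>. Call the class of such sets \<open>D\<close>. Since \<open>\<mu>\<^sub>t\<close> tends to the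
  point mass at 0 as \<open>t\<close> decreases to 0, the variables \<open>\<Pi>(B)\<close> with \<open>B \<in> D\<close> generate the whole
  \<open>\<sigma>\<close>-field up to null sets, while for \<open>B, C \<in> D\<close> the sets \<open>B\<close> and the preimage of \<open>C\<close> under \<open>g\<^sub>n\<close>
  are disjoint for large \<open>n\<close>, which makes cylinder events over \<open>D\<close> exactly independent of shifted
  ones. A Dynkin argument extends this to mixing along \<open>g\<^sub>n\<close>, and an invariant event of
  probability \<open>p\<close> satisfies \<open>p = p\<^sup>2\<close>.
\<close>

section \<open>Linear maps and Lebesgue measure\<close>

text \<open>The matrix arises from the identity by adding row \<open>n\<close> to row
  \<open>m\<close>, an operation that keeps the determinant. This and the next three lemmas supply
  the elementary cases of \<open>lebesgue_linear_image\<close>.\<close>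

lemma det_add_row_to_row:
  fixes m n :: "'n::finite"
  assumes "m \<noteq> n"
  shows "det (matrix (\<lambda>v::real^'n. \<chi> i. if i = m then v $ m + v $ n else v $ i)) = 1"
proof -
  have "matrix (\<lambda>v::real^'n. \<chi> i. if i = m then v $ m + v $ n else v $ i)
      = (\<chi> k. if k = m then row m (mat 1) + 1 *s row n (mat 1) else row k (mat 1))"
    by (auto simp: matrix_def row_def mat_def axis_def vec_eq_iff)
  then show ?thesis
    by (simp only: det_row_operation[OF assms] det_I)
qed

text \<open>The matrix is the identity with two rows exchanged, so its determinant is the sign of a
  transposition.\<close>

lemma det_transpose_coordinates:
  fixes m n :: "'n::finite"
  assumes "m \<noteq> n"
  shows "\<bar>det (matrix (\<lambda>v::real^'n. \<chi> i. v $ Transposition.transpose m n i))\<bar> = 1"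
proof -
  have "matrix (\<lambda>v::real^'n. \<chi> i. v $ Transposition.transpose m n i)
      = (\<chi> i. mat 1 $ Transposition.transpose m n i)"
    by (auto simp: matrix_def mat_def axis_def vec_eq_iff)
  then show ?thesis
    using assms by (simp add: det_permute_rows permutes_swap_id sign_swap_id)
qed

text \<open>The map is an involution that carries the box to the box with permuted corners, and
  permuting the side lengths keeps their product.\<close>

lemma measure_transpose_coordinates_cbox:
  fixes a b :: "real^'n"
  shows "measure lebesgue ((\<lambda>v. \<chi> i. v $ Transposition.transpose m n i) ` cbox a b)
       = measure lebesgue (cbox a b)"
proof (cases "cbox a b = {}")
  case False
  let ?h = "\<lambda>v::real^'n. \<chi> i. v $ Transposition.transpose m n i"
  have inv: "?h (?h v) = v" for v by (simp add: vec_eq_iff)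
  have mem: "?h v \<in> cbox (?h a) (?h b) \<longleftrightarrow> v \<in> cbox a b" for v
    by (simp add: mem_box_cart) (metis transpose_involutory)
  have image: "?h ` cbox a b = cbox (?h a) (?h b)"
  proof (intro equalityI subsetI)
    fix w assume "w \<in> cbox (?h a) (?h b)"
    then show "w \<in> ?h ` cbox a b" using mem[of "?h w"] inv[of w] by (metis image_eqI)
  qed (use mem in auto)
  have "(\<Prod>i\<in>UNIV. b $ Transposition.transpose m n i - a $ Transposition.transpose m n i)
      = (\<Prod>i\<in>UNIV. b $ i - a $ i)"
    by (rule prod.reindex_bij_betw) (rule bij_transpose)
  moreover have "cbox (?h a) (?h b) \<noteq> {}" using image False by auto
  ultimately show ?thesis by (simp add: image content_cbox_cart False)
qed simp

text \<open>A linear map turns translations into translations, so the lower corner can be moved to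
  the origin, where \<open>measure_shear_interval\<close> applies.\<close>

lemma measure_shear_cbox:
  fixes a b :: "real^'n"
  assumes "m \<noteq> n"
  shows "measure lebesgue ((\<lambda>v. \<chi> i. if i = m then v $ m + v $ n else v $ i) ` cbox a b)
       = measure lebesgue (cbox a b)"
proof (cases "cbox a b = {}")
  case False
  let ?h = "\<lambda>v::real^'n. \<chi> i. if i = m then v $ m + v $ n else v $ i"
  have lin: "linear ?h"
    by (rule linearI) (auto simp: vec_eq_iff algebra_simps)
  have box: "cbox a b = (+) a ` cbox 0 (b - a)"
    using cbox_translation[of a 0 "b - a"] by simp
  have "?h ` cbox a b = (+) (?h a) ` ?h ` cbox 0 (b - a)"
    unfolding box image_image using linear_add[OF lin] by simp
  then have "measure lebesgue (?h ` cbox a b) = measure lebesgue (?h ` cbox 0 (b - a))"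
    by (simp only: measure_translation)
  also have "\<dots> = measure lebesgue (cbox 0 (b - a))"
    using False by (intro measure_shear_interval assms) (auto simp: box)
  also have "\<dots> = measure lebesgue (cbox a b)"
    unfolding box by (simp only: measure_translation)
  finally show ?thesis .
qed simp

text \<open>The library's \<open>measure_linear_image\<close> needs a well-ordered index type.\<close>

lemma lebesgue_linear_image:
  fixes f :: "real^'n \<Rightarrow> real^'n"
  assumes "linear f"
  shows "\<forall>S\<in>lmeasurable. f ` S \<in> lmeasurable \<and>
           measure lebesgue (f ` S) = \<bar>det (matrix f)\<bar> * measure lebesgue S" (is "?P f")
  using assms
proof (rule induct_linear_elementary[where P = ?P])
  fix f g :: "real^'n \<Rightarrow> real^'n"
  assume "linear f" "linear g" and f: "?P f" and g: "?P g"
  have det: "\<bar>det (matrix (f \<circ> g))\<bar> = \<bar>det (matrix f)\<bar> * \<bar>det (matrix g)\<bar>"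
    using \<open>linear f\<close> \<open>linear g\<close> by (simp only: matrix_compose det_mul abs_mult)
  show "?P (f \<circ> g)"
    unfolding det image_comp[symmetric] mult.assoc
  proof
    fix S :: "(real^'n) set" assume "S \<in> lmeasurable"
    with g have "g ` S \<in> lmeasurable"
      "measure lebesgue (g ` S) = \<bar>det (matrix g)\<bar> * measure lebesgue S" by blast+
    with f show "f ` g ` S \<in> lmeasurable \<and>
        measure lebesgue (f ` g ` S) = \<bar>det (matrix f)\<bar> * (\<bar>det (matrix g)\<bar> * measure lebesgue S)"
      by metis
  qed
next
  fix f :: "real^'n \<Rightarrow> real^'n" and i
  assume f: "linear f" "\<And>x. f x $ i = 0"
  \<comment> \<open>An image inside a coordinate hyperplane makes \<open>f\<close> singular, so the
    image is negligible and the determinant is 0: both sides vanish.\<close>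
  then have "\<not> surj f"
    by (metis one_neq_zero surjD vec_component)
  then have inj: "\<not> inj f" using f(1) linear_injective_imp_surjective by blast
  then have neg: "negligible (f ` S)" for S
    using negligible_linear_singular_image f(1) by blast
  then show "?P f"
    using det_nz_iff_inj[OF f(1)] inj negligible_iff_measure by auto
next
  fix c :: "'n \<Rightarrow> real"
  have "det (matrix (\<lambda>x::real^'n. \<chi> i. c i * x $ i)) = prod c UNIV"
    by (subst det_diagonal) (auto simp: matrix_def axis_def)
  then show "?P (\<lambda>x. \<chi> i. c i * x $ i)"
    by (simp add: measurable_stretch measure_stretch)
next
  fix m n :: 'n assume "m \<noteq> n"
  have "linear (\<lambda>x::real^'n. \<chi> i. x $ Transposition.transpose m n i)"
    by (rule linearI) (auto simp: vec_eq_iff)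
  \<comment> \<open>A factor that is correct on all boxes is correct on all measurable sets; here
    the factor is 1.\<close>
  note suff = measure_linear_sufficient[OF this, where m = 1, OF _ measure_transpose_coordinates_cbox[THEN trans, OF mult_1[symmetric]]]
  show "?P (\<lambda>x. \<chi> i. x $ Transposition.transpose m n i)"
    unfolding det_transpose_coordinates[OF \<open>m \<noteq> n\<close>] by (blast dest: suff intro: sym)
next
  fix m n :: 'n assume "m \<noteq> n"
  have "linear (\<lambda>x::real^'n. \<chi> i. if i = m then x $ m + x $ n else x $ i)"
    by (rule linearI) (auto simp: vec_eq_iff algebra_simps)
  note suff = measure_linear_sufficient[OF this, where m = 1, OF _ measure_shear_cbox[OF \<open>m \<noteq> n\<close>, THEN trans, OF mult_1[symmetric]]]
  show "?P (\<lambda>x. \<chi> i. if i = m then x $ m + x $ n else x $ i)"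
    unfolding det_add_row_to_row[OF \<open>m \<noteq> n\<close>] abs_one by (blast dest: suff intro: sym)
qed

lemma finite_borel_iff_lmeasurable:
  "B \<in> finite_borel \<longleftrightarrow> B \<in> sets borel \<and> B \<in> lmeasurable"
  by (auto simp: finite_borel_def fmeasurable_def)

text \<open>Stated with preimages because \<open>noise_shift\<close> reindexes by preimages, and on
  \<open>finite_borel\<close> because these sets index the noise.\<close>

definition preserves_lebesgue :: "('a::euclidean_space \<Rightarrow> 'a) \<Rightarrow> bool" where
  "preserves_lebesgue g \<longleftrightarrow>
     (\<forall>B\<in>finite_borel. g -` B \<in> finite_borel \<and> measure lborel (g -` B) = measure lborel B)"

lemma unimodular_inverse:
  fixes A :: "real^'n^'n"
  assumes "\<bar>det A\<bar> = 1"
  obtains A' where "A' ** A = mat 1" "A ** A' = mat 1"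
  using assms invertible_det_nz[of A] unfolding invertible_def by (metis abs_zero zero_neq_one)

lemma vimage_matrix_eq_image:
  fixes A A' :: "real^'n^'n"
  assumes "A' ** A = mat 1" "A ** A' = mat 1"
  shows "(*v) A -` B = (*v) A' ` B"
proof -
  have *: "A *v (A' *v x) = x" "A' *v (A *v x) = x" for x
    using assms by (simp_all add: matrix_vector_mul_assoc)
  show ?thesis
  proof (intro equalityI subsetI)
    fix x assume "x \<in> (*v) A -` B"
    then show "x \<in> (*v) A' ` B" using *(2)[of x] by (metis image_eqI vimageE)
  qed (use *(1) in auto)
qed

text \<open>A preimage under \<open>A\<close> is an image under the inverse matrix, whose
  determinant also has absolute value 1. Continuity of \<open>A\<close> gives Borel
  measurability.\<close>

lemma preserves_lebesgue_unimodular: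
  fixes A :: "real^'n^'n"
  assumes A: "\<bar>det A\<bar> = 1"
  shows "preserves_lebesgue ((*v) A)"
  unfolding preserves_lebesgue_def
proof
  fix B :: "(real^'n) set" assume B: "B \<in> finite_borel"
  obtain A' where A': "A' ** A = mat 1" "A ** A' = mat 1"
    using unimodular_inverse[OF A] .
  then have "det A' * det A = 1" by (metis det_I det_mul)
  then have det: "\<bar>det A'\<bar> = 1" using A by (metis abs_1 abs_mult mult_1_right)
  have "(*v) A -` B \<inter> space borel \<in> sets borel"
    using B by (intro measurable_sets[of _ borel borel] borel_measurable_continuous_onI
        matrix_vector_mult_linear_continuous_on) (auto simp: finite_borel_def)
  then show "(*v) A -` B \<in> finite_borel \<and> measure lborel ((*v) A -` B) = measure lborel B"
    using lebesgue_linear_image[of "(*v) A'"] B det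
    by (auto simp: finite_borel_iff_lmeasurable vimage_matrix_eq_image[OF A'])
qed

section \<open>Overlap of a ball with its preimage under a large matrix\<close>

text \<open>Row \<open>j\<close> is \<open>v $ j\<close> times a unit vector plus a combination
  \<open>x\<close> of the other rows. Dropping \<open>x\<close> keeps the determinant and leaves the
  diagonal matrix \<open>D\<close>.\<close>

lemma det_replace_row:
  fixes v :: "real^'n"
  shows "det (\<chi> k. if k = j then v else axis k 1) = v $ j"
proof -
  define D :: "real^'n^'n" where "D = (\<chi> k. if k = j then (v $ j) *s axis j 1 else axis k 1)"
  define x where "x = (\<Sum>l\<in>UNIV - {j}. v $ l *s axis l (1::real))"
  have "x \<in> vec.span {row l D |l. l \<noteq> j}"
    unfolding x_def
  proof (intro vec.span_sum vec.span_scale vec.span_base)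
    fix l assume "l \<in> UNIV - {j}"
    then have "row l D = axis l 1" "l \<noteq> j" by (auto simp: D_def row_def vec_eq_iff)
    then show "axis l 1 \<in> {row l D |l. l \<noteq> j}" by (auto intro!: exI[of _ l])
  qed
  from det_row_span[OF this]
  have "det (\<chi> k. if k = j then row j D + x else row k D) = det D" .
  also have "(\<chi> k. if k = j then row j D + x else row k D) = (\<chi> k. if k = j then v else axis k 1)"
  proof -
    have "row j D + x = v"
      by (auto simp: D_def row_def x_def vec_eq_iff axis_def if_distrib cong: if_cong)
    then show ?thesis by (auto simp: D_def row_def vec_eq_iff)
  qed
  also have "det D = v $ j"
  proof (subst det_diagonal)
    have "D $ i $ i = (if i = j then v $ j else 1)" for i by (auto simp: D_def axis_def)
    then show "(\<Prod>i\<in>UNIV. D $ i $ i) = v $ j" by simp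
  qed (auto simp: D_def axis_def)
  finally show ?thesis .
qed

text \<open>The set is contained in a slab of width about \<open>2 * R / \<bar>A $ i $ j\<bar>\<close>; replacing the \<open>j\<close>-th
  coordinate by the \<open>i\<close>-th coordinate of \<open>A *v x\<close> maps it into a cube.\<close>

lemma measure_overlap_bound:
  fixes A :: "real^'n^'n"
  assumes "R \<ge> 0"
  shows "\<bar>A $ i $ j\<bar> * measure lborel (cball 0 R \<inter> (*v) A -` cball 0 R) \<le> (2 * R) ^ CARD('n)"
proof -
  define M :: "real^'n^'n" where "M = (\<chi> k. if k = j then A $ i else axis k 1)"
  define S where "S = cball 0 R \<inter> (*v) A -` cball (0::real^'n) R"
  have "closed ((*v) A -` cball 0 R)"
    by (intro closed_vimage continuous_intros) auto
  then have "compact S" unfolding S_def by (intro compact_Int_closed) auto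
  then have S: "S \<in> lmeasurable" "S \<in> sets borel"
    by (auto simp: lmeasurable_compact compact_imp_closed)
  have M: "(M *v x) $ k = (if k = j then (A *v x) $ i else x $ k)" for x k
    by (auto simp: M_def matrix_vector_mult_def axis_def if_distrib[of "\<lambda>a. a * _"] cong: if_cong)
  \<comment> \<open>Each coordinate of \<open>M *v x\<close> is a coordinate of \<open>x\<close> or
    of \<open>A *v x\<close>, and both vectors have norm at most \<open>R\<close> on
    \<open>S\<close>.\<close>
  have "(*v) M ` S \<subseteq> cbox (\<chi> k. -R) (\<chi> k. R)"
  proof clarify
    fix x assume "x \<in> S"
    then have "norm x \<le> R" "norm (A *v x) \<le> R" by (auto simp: S_def)
    then have "\<bar>(M *v x) $ k\<bar> \<le> R" for k
      using component_le_norm_cart[of x k] component_le_norm_cart[of "A *v x" i] by (simp add: M)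
    then show "M *v x \<in> cbox (\<chi> k. -R) (\<chi> k. R)"
      by (simp add: mem_box_cart abs_le_iff) (metis minus_le_iff)
  qed
  then have "measure lebesgue ((*v) M ` S) \<le> measure lebesgue (cbox (\<chi> k::'n. -R) (\<chi> k. R))"
    using lebesgue_linear_image[of "(*v) M"] S by (intro measure_mono_fmeasurable) auto
  also have "\<dots> = (2 * R) ^ CARD('n)"
    using assms by (simp add: content_cbox_if_cart interval_eq_empty_cart not_less)
  also have "measure lebesgue ((*v) M ` S) = \<bar>A $ i $ j\<bar> * measure lebesgue S"
    using lebesgue_linear_image[of "(*v) M"] S
    by (simp add: M_def det_replace_row)
  finally show ?thesis using S by (simp add: S_def)
qed

text \<open>The norm is at most the sum of the absolute values of all entries, so entries bounded by
  \<open>K\<close> would bound it.\<close>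

lemma large_entry:
  fixes A :: "real^'n^'n" and K :: real
  assumes "norm A > K * CARD('n) * CARD('n)"
  obtains i j where "\<bar>A $ i $ j\<bar> > K"
proof (rule ccontr)
  assume "\<not> thesis"
  then have le: "\<bar>A $ i $ j\<bar> \<le> K" for i j using that by (meson not_le)
  have "norm A \<le> (\<Sum>i\<in>UNIV. norm (A $ i))"
    unfolding norm_vec_def by (rule L2_set_le_sum) simp
  also have "\<dots> \<le> (\<Sum>i\<in>(UNIV::'n set). K * CARD('n))"
  proof (rule sum_mono)
    fix i
    have "norm (A $ i) \<le> (\<Sum>j\<in>UNIV. \<bar>A $ i $ j\<bar>)" by (rule norm_le_l1_cart)
    also have "\<dots> \<le> (\<Sum>j\<in>(UNIV::'n set). K)" by (intro sum_mono le)
    finally show "norm (A $ i) \<le> K * CARD('n)" by (simp add: mult.commute)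
  qed
  finally show False using assms by (simp add: mult_ac)
qed

lemma small_overlap:
  fixes G :: "(real^'n^'n) set"
  assumes "\<not> bounded G" "R \<ge> 0" "e > 0"
  obtains A where "A \<in> G" "measure lborel (cball 0 R \<inter> (*v) A -` cball 0 R) < e"
proof -
  \<comment> \<open>The threshold is chosen so that an entry above \<open>K\<close> brings the bound
    of \<open>measure_overlap_bound\<close> below \<open>e\<close>.\<close>
  define K where "K = (2 * R) ^ CARD('n) / e"
  have K: "K \<ge> 0" using assms by (simp add: K_def)
  obtain A where A: "A \<in> G" "norm A > K * CARD('n) * CARD('n)"
    using assms(1) unfolding bounded_iff by (meson not_le)
  then obtain i j where "\<bar>A $ i $ j\<bar> > K" using large_entry by blast
  moreover from this have pos: "\<bar>A $ i $ j\<bar> > 0"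
    using K by linarith
  ultimately have "(2 * R) ^ CARD('n) < e * \<bar>A $ i $ j\<bar>"
    using assms by (simp add: K_def divide_less_eq mult.commute)
  with measure_overlap_bound[OF assms(2), of A i j]
  have "\<bar>A $ i $ j\<bar> * measure lborel (cball 0 R \<inter> (*v) A -` cball 0 R) < \<bar>A $ i $ j\<bar> * e"
    by (simp add: mult.commute)
  then show ?thesis using A pos that by simp
qed

section \<open>Finite-dimensional distributions of the noise\<close>

text \<open>In \<open>levy_noise\<close> the semigroup stands behind an existential quantifier; the
  locale fixes one as \<open>\<mu>t\<close>.\<close>

locale noise = prob_space P for P :: "'w measure" +
  fixes \<mu>t :: "real \<Rightarrow> real measure" and \<Xi> :: "'a::euclidean_space set \<Rightarrow> 'w \<Rightarrow> real"
  assumes measurable_Xi: "\<And>B. B \<in> finite_borel \<Longrightarrow> \<Xi> B \<in> borel_measurable P"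
    and distr_Xi: "\<And>B. B \<in> finite_borel \<Longrightarrow> distr P borel (\<Xi> B) = \<mu>t (measure lborel B)"
    and indep_seq: "\<And>B n. B ` {..<n::nat} \<subseteq> finite_borel \<Longrightarrow> disjoint_family_on B {..<n} \<Longrightarrow>
      indep_vars (\<lambda>_. borel) (\<lambda>i. \<Xi> (B i)) {..<n}"
    and additive_seq: "\<And>B n. B ` {..<n::nat} \<subseteq> finite_borel \<Longrightarrow> disjoint_family_on B {..<n} \<Longrightarrow>
      AE \<omega> in P. \<Xi> (\<Union>i<n. B i) \<omega> = (\<Sum>i<n. \<Xi> (B i) \<omega>)"
    and law_zero: "\<mu>t 0 = return borel 0"
    and law_continuous: "\<And>r. filterlim r (at_right 0) sequentially \<Longrightarrow>
      weak_conv_m (\<lambda>n. \<mu>t (r n)) (return borel 0)"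
    and real_distribution_law: "\<And>t. t \<ge> 0 \<Longrightarrow> real_distribution (\<mu>t t)"
begin

text \<open>Carries the axioms, stated for initial segments of the naturals, over to arbitrary
  finite index sets. The index sets needed below consist of subsets of another index set.\<close>

lemma finite_family_reindex:
  fixes B :: "'i \<Rightarrow> 'a set"
  assumes "finite I" "\<And>i. i \<in> I \<Longrightarrow> B i \<in> finite_borel" "disjoint_family_on B I"
  obtains h where "bij_betw h {..<card I} I" "(B \<circ> h) ` {..<card I} \<subseteq> finite_borel"
    "disjoint_family_on (B \<circ> h) {..<card I}"
proof -
  obtain h where h: "bij_betw h {..<card I} I"
    using ex_bij_betw_nat_finite[OF assms(1)] by (auto simp: atLeast0LessThan)
  have "disjoint_family_on (B \<circ> h) {..<card I}"
    unfolding disjoint_family_on_def comp_def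
  proof (intro ballI impI)
    fix m n assume "m \<in> {..<card I}" "n \<in> {..<card I}" "m \<noteq> n"
    then have "h m \<in> I" "h n \<in> I" "h m \<noteq> h n" using h by (auto simp: bij_betw_def inj_on_def)
    then show "B (h m) \<inter> B (h n) = {}" using assms(3) by (simp add: disjoint_family_on_def)
  qed
  moreover have "(B \<circ> h) ` {..<card I} \<subseteq> finite_borel"
    using assms(2) h by (auto simp: bij_betw_def)
  ultimately show ?thesis using h that by blast
qed

lemma indep_Xi:
  fixes B :: "'i \<Rightarrow> 'a set"
  assumes "finite I" and B: "\<And>i. i \<in> I \<Longrightarrow> B i \<in> finite_borel" and "disjoint_family_on B I"
  shows "indep_vars (\<lambda>_. borel) (\<lambda>i. \<Xi> (B i)) I"
proof (cases "I = {}")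
  case True
  then show ?thesis by (simp add: indep_vars_def indep_sets_def)
next
  case False
  from finite_family_reindex[OF assms] obtain h where h: "bij_betw h {..<card I} I"
    "(B \<circ> h) ` {..<card I} \<subseteq> finite_borel" "disjoint_family_on (B \<circ> h) {..<card I}" .
  have I: "I = h ` {..<card I}" using h(1) by (simp add: bij_betw_def)
  have indep: "indep_vars (\<lambda>_. borel) (\<lambda>i. \<Xi> (B (h i))) {..<card I}"
    using indep_seq[OF h(2,3)] by simp
  show ?thesis
  proof (subst indep_vars_finite[where E = "\<lambda>_. sets borel"])
    show "\<forall>A\<in>I \<rightarrow> sets borel. prob (\<Inter>j\<in>I. \<Xi> (B j) -` A j \<inter> space P)
        = (\<Prod>j\<in>I. prob (\<Xi> (B j) -` A j \<inter> space P))"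
    proof
      fix A :: "'i \<Rightarrow> real set" assume A: "A \<in> I \<rightarrow> sets borel"
      have "prob (\<Inter>j\<in>I. \<Xi> (B j) -` A j \<inter> space P)
          = prob (\<Inter>i<card I. \<Xi> (B (h i)) -` A (h i) \<inter> space P)"
        by (subst I) simp
      also have "\<dots> = (\<Prod>i<card I. prob (\<Xi> (B (h i)) -` A (h i) \<inter> space P))"
        using False A h(1) assms(1)
        by (intro indep_varsD_finite[OF indep]) (auto simp: bij_betw_def)
      also have "\<dots> = (\<Prod>j\<in>I. prob (\<Xi> (B j) -` A j \<inter> space P))"
        by (rule prod.reindex_bij_betw[OF h(1)])
      finally show "prob (\<Inter>j\<in>I. \<Xi> (B j) -` A j \<inter> space P)
        = (\<Prod>j\<in>I. prob (\<Xi> (B j) -` A j \<inter> space P))" .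
    qed
  qed (use False assms in \<open>auto intro: measurable_Xi simp: Int_stable_def sets.sigma_sets_eq[of borel, simplified]\<close>)
qed

lemma additive_Xi:
  fixes B :: "'i \<Rightarrow> 'a set"
  assumes "finite I" "\<And>i. i \<in> I \<Longrightarrow> B i \<in> finite_borel" "disjoint_family_on B I"
  shows "AE \<omega> in P. \<Xi> (\<Union>i\<in>I. B i) \<omega> = (\<Sum>i\<in>I. \<Xi> (B i) \<omega>)"
proof -
  from finite_family_reindex[OF assms] obtain h where h: "bij_betw h {..<card I} I"
    "(B \<circ> h) ` {..<card I} \<subseteq> finite_borel" "disjoint_family_on (B \<circ> h) {..<card I}" .
  have "(\<Union>i<card I. B (h i)) = (\<Union>i\<in>I. B i)"
    using h(1) by (simp add: bij_betw_def flip: image_image)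
  moreover have "(\<Sum>i<card I. \<Xi> (B (h i)) \<omega>) = (\<Sum>i\<in>I. \<Xi> (B i) \<omega>)" for \<omega>
    by (rule sum.reindex_bij_betw[OF h(1)])
  ultimately show ?thesis using additive_seq[OF h(2,3)] by simp
qed

end

section \<open>Atoms of a finite family of sets\<close>

text \<open>These are the cells of the Venn diagram of the sets \<open>B i\<close>. The cell for
  \<open>I = {}\<close> is the outside of all of them and has infinite volume for a finite family in
  \<open>finite_borel\<close>, which is why nonempty \<open>I\<close> is demanded later.\<close>

definition atom :: "('i \<Rightarrow> 'a set) \<Rightarrow> 'i set \<Rightarrow> 'i set \<Rightarrow> 'a set" where
  "atom B J I = {x. {i \<in> J. x \<in> B i} = I}"

lemma disjoint_family_atom: "disjoint_family_on (atom B J) K"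
  by (auto simp: disjoint_family_on_def atom_def)

lemma atom_vimage: "atom (\<lambda>i. g -` B i) J I = g -` atom B J I"
  by (auto simp: atom_def)

lemma UN_atom: "j \<in> J \<Longrightarrow> (\<Union>I\<in>{I. I \<subseteq> J \<and> j \<in> I}. atom B J I) = B j" (is "_ \<Longrightarrow> ?U = _")
proof (intro equalityI subsetI)
  fix x assume "j \<in> J" "x \<in> B j"
  then have "x \<in> atom B J {i \<in> J. x \<in> B i}" "{i \<in> J. x \<in> B i} \<in> {I. I \<subseteq> J \<and> j \<in> I}"
    by (auto simp: atom_def)
  then show "x \<in> ?U" by blast
qed (auto simp: atom_def)

lemma finite_borel_subset: "A \<in> finite_borel \<Longrightarrow> B \<subseteq> A \<Longrightarrow> B \<in> sets borel \<Longrightarrow> B \<in> finite_borel"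
  using emeasure_mono[of B A lborel] by (auto simp: finite_borel_def intro: le_less_trans)

lemma atom_finite_borel:
  assumes J: "finite J" "\<And>j. j \<in> J \<Longrightarrow> B j \<in> finite_borel" and I: "I \<subseteq> J" "I \<noteq> {}"
  shows "atom B J I \<in> finite_borel"
proof -
  obtain i where i: "i \<in> I" using I by blast
  have "{x \<in> space borel. x \<in> B j \<longleftrightarrow> j \<in> I} \<in> sets borel" if "j \<in> J" for j
  proof -
    have "{x \<in> space borel. x \<in> B j \<longleftrightarrow> j \<in> I} = (if j \<in> I then B j else - B j)" by auto
    then show ?thesis using J(2)[OF that] by (simp add: finite_borel_def borel_comp)
  qed
  then have "{x \<in> space borel. \<forall>j\<in>J. x \<in> B j \<longleftrightarrow> j \<in> I} \<in> sets borel"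
    by (rule sets.sets_Collect_finite_All[OF _ J(1)])
  moreover have "atom B J I = {x \<in> space borel. \<forall>j\<in>J. x \<in> B j \<longleftrightarrow> j \<in> I}"
    using I by (auto simp: atom_def)
  ultimately have "atom B J I \<in> sets borel" by (rule ssubst[rotated])
  moreover have "atom B J I \<subseteq> B i" using i unfolding atom_def by blast
  moreover have "B i \<in> finite_borel" using i I J(2) by blast
  ultimately show ?thesis using finite_borel_subset by blast
qed

context noise
begin

text \<open>Each \<open>B j\<close> is the disjoint union of the cells whose index contains
  \<open>j\<close>. Additivity holds outside a null set for each \<open>j\<close>, and there are
  finitely many \<open>j\<close>.\<close>

lemma Xi_eq_sum_atom:
  assumes J: "finite J" "\<And>j. j \<in> J \<Longrightarrow> B j \<in> finite_borel"
  shows "AE \<omega> in P. \<forall>j\<in>J. \<Xi> (B j) \<omega> = (\<Sum>I | I \<subseteq> J \<and> j \<in> I. \<Xi> (atom B J I) \<omega>)"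
proof (rule AE_finite_allI[OF J(1)])
  fix j assume "j \<in> J"
  moreover have "atom B J I \<in> finite_borel" if "I \<in> {I. I \<subseteq> J \<and> j \<in> I}" for I
    using that by (intro atom_finite_borel J) auto
  ultimately show "AE \<omega> in P. \<Xi> (B j) \<omega> = (\<Sum>I | I \<subseteq> J \<and> j \<in> I. \<Xi> (atom B J I) \<omega>)"
    using additive_Xi[of "{I. I \<subseteq> J \<and> j \<in> I}" "atom B J"] J(1)
    by (simp add: disjoint_family_atom UN_atom)
qed

lemma indep_atoms:
  assumes "finite J" "\<And>j. j \<in> J \<Longrightarrow> B j \<in> finite_borel"
  shows "indep_vars (\<lambda>_. borel) (\<lambda>I. \<Xi> (atom B J I)) (Pow J - {{}})"
  using assms by (intro indep_Xi disjoint_family_atom atom_finite_borel) auto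

text \<open>The cells carry independent values with known laws, and the values on the
  \<open>B j\<close> are sums of these. Hence the joint law depends on the family only through the
  volumes of its cells.\<close>

lemma distr_finite_family:
  assumes J: "finite J" "\<And>j. j \<in> J \<Longrightarrow> B j \<in> finite_borel" "J \<noteq> {}"
  shows "distr P (\<Pi>\<^sub>M j\<in>J. borel) (\<lambda>\<omega>. \<lambda>j\<in>J. \<Xi> (B j) \<omega>)
       = distr (\<Pi>\<^sub>M I\<in>Pow J - {{}}. \<mu>t (measure lborel (atom B J I))) (\<Pi>\<^sub>M j\<in>J. borel)
           (\<lambda>x. \<lambda>j\<in>J. \<Sum>I | I \<subseteq> J \<and> j \<in> I. x I)" (is "_ = distr ?Q _ ?sum")
proof -
  let ?K = "Pow J - {{}}"
  let ?X = "\<lambda>\<omega>. \<lambda>I\<in>?K. \<Xi> (atom B J I) \<omega>"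
  have atom: "atom B J I \<in> finite_borel" if "I \<in> ?K" for I
    using that by (intro atom_finite_borel J) auto
  have X: "?X \<in> measurable P (\<Pi>\<^sub>M I\<in>?K. borel)"
    using atom by (intro measurable_restrict measurable_Xi)
  have sum: "?sum \<in> measurable (\<Pi>\<^sub>M I\<in>?K. borel) (\<Pi>\<^sub>M j\<in>J. borel)"
    by (intro measurable_restrict borel_measurable_sum measurable_component_singleton) auto
  \<comment> \<open>The description of independence by a product measure is applied to a nonempty
    index set, hence the assumption on \<open>J\<close>.\<close>
  have "?K \<noteq> {}" using J(3) by blast
  moreover have "indep_vars (\<lambda>_. borel) (\<lambda>I. \<Xi> (atom B J I)) ?K"
    using J by (intro indep_atoms)
  moreover have "(\<Pi>\<^sub>M I\<in>?K. distr P borel (\<Xi> (atom B J I))) = ?Q"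
    by (intro PiM_cong refl distr_Xi atom)
  ultimately have Q: "distr P (\<Pi>\<^sub>M I\<in>?K. borel) ?X = ?Q"
    using indep_vars_iff_distr_eq_PiM'[of ?K "\<lambda>I. \<Xi> (atom B J I)" "\<lambda>_. borel"] atom
    by (simp add: measurable_Xi)
  have ae: "AE \<omega> in P. \<forall>j\<in>J. \<Xi> (B j) \<omega> = (\<Sum>I | I \<subseteq> J \<and> j \<in> I. \<Xi> (atom B J I) \<omega>)"
    using J by (intro Xi_eq_sum_atom)
  have "distr P (\<Pi>\<^sub>M j\<in>J. borel) (\<lambda>\<omega>. \<lambda>j\<in>J. \<Xi> (B j) \<omega>)
      = distr P (\<Pi>\<^sub>M j\<in>J. borel) (\<lambda>\<omega>. ?sum (?X \<omega>))"
  proof (rule distr_cong_AE)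
    show "AE \<omega> in P. (\<lambda>j\<in>J. \<Xi> (B j) \<omega>) = ?sum (?X \<omega>)"
      using ae by eventually_elim (auto intro!: restrict_ext sum.cong)
    show "(\<lambda>\<omega>. \<lambda>j\<in>J. \<Xi> (B j) \<omega>) \<in> measurable P (\<Pi>\<^sub>M j\<in>J. borel)"
      by (intro measurable_restrict measurable_Xi J)
    show "(\<lambda>\<omega>. ?sum (?X \<omega>)) \<in> measurable P (\<Pi>\<^sub>M j\<in>J. borel)"
      using measurable_compose[OF X sum] by simp
  qed auto
  also have "\<dots> = distr (distr P (\<Pi>\<^sub>M I\<in>?K. borel) ?X) (\<Pi>\<^sub>M j\<in>J. borel) ?sum"
    by (subst distr_distr[OF sum X]) (simp add: comp_def)
  finally show ?thesis by (simp only: Q)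
qed

section \<open>Invariance and independence of finite-dimensional events\<close>

text \<open>The cells of the preimages are the preimages of the cells and have the same volumes, so
  \<open>distr_finite_family\<close> yields the same joint law.\<close>

lemma prob_vimage_family:
  assumes J: "finite J" "\<And>j. j \<in> J \<Longrightarrow> B j \<in> finite_borel"
    and g: "preserves_lebesgue g" and U: "\<And>j. j \<in> J \<Longrightarrow> U j \<in> sets borel"
  shows "prob {\<omega> \<in> space P. \<forall>j\<in>J. \<Xi> (g -` B j) \<omega> \<in> U j}
       = prob {\<omega> \<in> space P. \<forall>j\<in>J. \<Xi> (B j) \<omega> \<in> U j}"
proof (cases "J = {}")
  case False
  have E: "Pi\<^sub>E J U \<in> sets (\<Pi>\<^sub>M j\<in>J. borel)" using J(1) U by (rule sets_PiM_I_finite)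
  have gB: "g -` B j \<in> finite_borel" if "j \<in> J" for j
    using g J(2)[OF that] by (simp add: preserves_lebesgue_def)
  have *: "prob {\<omega> \<in> space P. \<forall>j\<in>J. \<Xi> (C j) \<omega> \<in> U j}
      = measure (distr P (\<Pi>\<^sub>M j\<in>J. borel) (\<lambda>\<omega>. \<lambda>j\<in>J. \<Xi> (C j) \<omega>)) (Pi\<^sub>E J U)"
    if "\<And>j. j \<in> J \<Longrightarrow> C j \<in> finite_borel" for C
    using that E
    by (subst measure_distr) (auto intro!: measurable_restrict measurable_Xi arg_cong[where f = prob])
  have "measure lborel (atom (\<lambda>j. g -` B j) J I) = measure lborel (atom B J I)"
    if "I \<in> Pow J - {{}}" for I
    using g that atom_finite_borel[of J B I] J by (simp add: atom_vimage preserves_lebesgue_def)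
  then have PiM: "(\<Pi>\<^sub>M I\<in>Pow J - {{}}. \<mu>t (measure lborel (atom (\<lambda>j. g -` B j) J I)))
      = (\<Pi>\<^sub>M I\<in>Pow J - {{}}. \<mu>t (measure lborel (atom B J I)))"
    by (intro PiM_cong) simp_all
  have "distr P (\<Pi>\<^sub>M j\<in>J. borel) (\<lambda>\<omega>. \<lambda>j\<in>J. \<Xi> (g -` B j) \<omega>)
      = distr P (\<Pi>\<^sub>M j\<in>J. borel) (\<lambda>\<omega>. \<lambda>j\<in>J. \<Xi> (B j) \<omega>)"
    using distr_finite_family[of J "\<lambda>j. g -` B j"] distr_finite_family[of J B] J gB False
    by (simp add: PiM)
  then show ?thesis by (simp add: * gB J(2))
qed simp

lemma events_Xi:
  assumes "finite J" "\<And>j. j \<in> J \<Longrightarrow> B j \<in> finite_borel" "\<And>j. j \<in> J \<Longrightarrow> U j \<in> sets borel"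
  shows "{\<omega> \<in> space P. \<forall>j\<in>J. \<Xi> (B j) \<omega> \<in> U j} \<in> events"
  using assms
  by (intro sets.sets_Collect_finite_All predE pred_sets2[where N = borel] measurable_Xi) auto

text \<open>Cells of the first family are disjoint from cells of the second, so all cell values
  together are independent. Grouping them by family gives two independent vectors that determine the
  two events up to null sets.\<close>

lemma prob_disjoint_families:
  assumes J: "finite J" "\<And>j. j \<in> J \<Longrightarrow> B j \<in> finite_borel" "\<And>j. j \<in> J \<Longrightarrow> U j \<in> sets borel"
    and K: "finite K" "\<And>k. k \<in> K \<Longrightarrow> C k \<in> finite_borel" "\<And>k. k \<in> K \<Longrightarrow> V k \<in> sets borel"
    and disj: "\<And>j k. j \<in> J \<Longrightarrow> k \<in> K \<Longrightarrow> B j \<inter> C k = {}"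
  shows "prob {\<omega> \<in> space P. (\<forall>j\<in>J. \<Xi> (B j) \<omega> \<in> U j) \<and> (\<forall>k\<in>K. \<Xi> (C k) \<omega> \<in> V k)}
       = prob {\<omega> \<in> space P. \<forall>j\<in>J. \<Xi> (B j) \<omega> \<in> U j} * prob {\<omega> \<in> space P. \<forall>k\<in>K. \<Xi> (C k) \<omega> \<in> V k}"
proof -
  \<comment> \<open>The sum type puts the cells of both families into one indexed family and keeps
    track of their origin.\<close>
  define D where "D = case_sum (atom B J) (atom C K)"
  let ?L = "Inl ` (Pow J - {{}})" and ?R = "Inr ` (Pow K - {{}})"
  have D: "D i \<in> finite_borel" if "i \<in> ?L \<union> ?R" for i
    using that J K by (auto simp: D_def intro!: atom_finite_borel)
  have "disjoint_family_on D (?L \<union> ?R)"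
    using disj by (fastforce simp: disjoint_family_on_def D_def atom_def)
  then have "indep_vars (\<lambda>_. borel) (\<lambda>i. \<Xi> (D i)) (?L \<union> ?R)"
    using J K D by (intro indep_Xi) auto
  then have indep: "indep_var (PiM ?L (\<lambda>_. borel)) (\<lambda>\<omega>. restrict (\<lambda>i. \<Xi> (D i) \<omega>) ?L)
      (PiM ?R (\<lambda>_. borel)) (\<lambda>\<omega>. restrict (\<lambda>i. \<Xi> (D i) \<omega>) ?R)"
    by (rule indep_var_restrict) auto
  \<comment> \<open>The two events expressed through the cell values alone, with each value on a set
    replaced by a sum over its cells.\<close>
  let ?E = "{x \<in> space (PiM ?L (\<lambda>_. borel)). \<forall>j\<in>J. (\<Sum>I | I \<subseteq> J \<and> j \<in> I. x (Inl I)) \<in> U j}"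
  let ?F = "{x \<in> space (PiM ?R (\<lambda>_. borel)). \<forall>k\<in>K. (\<Sum>I | I \<subseteq> K \<and> k \<in> I. x (Inr I)) \<in> V k}"
  let ?X = "\<lambda>\<omega>. \<lambda>i\<in>?L. \<Xi> (D i) \<omega>" and ?Y = "\<lambda>\<omega>. \<lambda>i\<in>?R. \<Xi> (D i) \<omega>"
  have E: "?E \<in> sets (PiM ?L (\<lambda>_. borel))"
    using J by (intro sets.sets_Collect_finite_All predE pred_sets2[where N = borel]
        borel_measurable_sum measurable_component_singleton) auto
  have F: "?F \<in> sets (PiM ?R (\<lambda>_. borel))"
    using K by (intro sets.sets_Collect_finite_All predE pred_sets2[where N = borel]
        borel_measurable_sum measurable_component_singleton) auto
  have X: "?X \<in> measurable P (PiM ?L (\<lambda>_. borel))" and Y: "?Y \<in> measurable P (PiM ?R (\<lambda>_. borel))"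
    using D by (auto intro!: measurable_restrict measurable_Xi)
  have spaceX: "?X \<omega> \<in> space (PiM ?L (\<lambda>_. borel))" and spaceY: "?Y \<omega> \<in> space (PiM ?R (\<lambda>_. borel))" for \<omega>
    by (auto simp: space_PiM)
  have XE: "?X \<omega> \<in> ?E \<longleftrightarrow> (\<forall>j\<in>J. (\<Sum>I | I \<subseteq> J \<and> j \<in> I. \<Xi> (atom B J I) \<omega>) \<in> U j)" for \<omega>
  proof -
    have "(\<Sum>I | I \<subseteq> J \<and> j \<in> I. ?X \<omega> (Inl I)) = (\<Sum>I | I \<subseteq> J \<and> j \<in> I. \<Xi> (atom B J I) \<omega>)" for j
      by (rule sum.cong) (auto simp: D_def)
    then show ?thesis using spaceX by (simp del: restrict_apply)
  qed
  have YF: "?Y \<omega> \<in> ?F \<longleftrightarrow> (\<forall>k\<in>K. (\<Sum>I | I \<subseteq> K \<and> k \<in> I. \<Xi> (atom C K I) \<omega>) \<in> V k)" for \<omega>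
  proof -
    have "(\<Sum>I | I \<subseteq> K \<and> k \<in> I. ?Y \<omega> (Inr I)) = (\<Sum>I | I \<subseteq> K \<and> k \<in> I. \<Xi> (atom C K I) \<omega>)" for k
      by (rule sum.cong) (auto simp: D_def)
    then show ?thesis using spaceY by (simp del: restrict_apply)
  qed
  have ae: "AE \<omega> in P. \<forall>j\<in>J. \<Xi> (B j) \<omega> = (\<Sum>I | I \<subseteq> J \<and> j \<in> I. \<Xi> (atom B J I) \<omega>)"
    "AE \<omega> in P. \<forall>k\<in>K. \<Xi> (C k) \<omega> = (\<Sum>I | I \<subseteq> K \<and> k \<in> I. \<Xi> (atom C K I) \<omega>)"
    using J K by (intro Xi_eq_sum_atom; simp)+
  have aeX: "AE \<omega> in P. (\<forall>j\<in>J. \<Xi> (B j) \<omega> \<in> U j) \<longleftrightarrow> ?X \<omega> \<in> ?E"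
    using ae(1) by eventually_elim (simp only: XE, simp)
  have aeY: "AE \<omega> in P. (\<forall>k\<in>K. \<Xi> (C k) \<omega> \<in> V k) \<longleftrightarrow> ?Y \<omega> \<in> ?F"
    using ae(2) by eventually_elim (simp only: YF, simp)
  have [measurable]: "{\<omega> \<in> space P. \<forall>j\<in>J. \<Xi> (B j) \<omega> \<in> U j} \<in> events"
    "{\<omega> \<in> space P. \<forall>k\<in>K. \<Xi> (C k) \<omega> \<in> V k} \<in> events"
    by (intro events_Xi J K; assumption)+
  have XE_ev: "?X -` ?E \<inter> space P \<in> events" "?Y -` ?F \<inter> space P \<in> events"
    using measurable_sets[OF X E] measurable_sets[OF Y F] by auto
  have "prob {\<omega> \<in> space P. (\<forall>j\<in>J. \<Xi> (B j) \<omega> \<in> U j) \<and> (\<forall>k\<in>K. \<Xi> (C k) \<omega> \<in> V k)}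
      = prob ((?X -` ?E \<inter> space P) \<inter> (?Y -` ?F \<inter> space P))"
  proof (rule measure_eq_AE)
    have "{\<omega> \<in> space P. (\<forall>j\<in>J. \<Xi> (B j) \<omega> \<in> U j) \<and> (\<forall>k\<in>K. \<Xi> (C k) \<omega> \<in> V k)}
      = {\<omega> \<in> space P. \<forall>j\<in>J. \<Xi> (B j) \<omega> \<in> U j} \<inter> {\<omega> \<in> space P. \<forall>k\<in>K. \<Xi> (C k) \<omega> \<in> V k}"
      by auto
    then show "{\<omega> \<in> space P. (\<forall>j\<in>J. \<Xi> (B j) \<omega> \<in> U j) \<and> (\<forall>k\<in>K. \<Xi> (C k) \<omega> \<in> V k)} \<in> events"
      by simp
    show "?X -` ?E \<inter> space P \<inter> (?Y -` ?F \<inter> space P) \<in> events" using XE_ev by blast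
  qed (use aeX aeY in \<open>eventually_elim, blast\<close>)
  also have "\<dots> = prob ((\<lambda>\<omega>. (?X \<omega>, ?Y \<omega>)) -` (?E \<times> ?F) \<inter> space P)"
    by (rule arg_cong[where f = prob]) auto
  also have "\<dots> = prob (?X -` ?E \<inter> space P) * prob (?Y -` ?F \<inter> space P)"
    by (rule indep_varD[OF indep E F])
  also have "prob (?X -` ?E \<inter> space P) = prob {\<omega> \<in> space P. \<forall>j\<in>J. \<Xi> (B j) \<omega> \<in> U j}"
    by (rule measure_eq_AE) (use aeX XE_ev in \<open>auto elim!: eventually_mono\<close>)
  also have "prob (?Y -` ?F \<inter> space P) = prob {\<omega> \<in> space P. \<forall>k\<in>K. \<Xi> (C k) \<omega> \<in> V k}"
    by (rule measure_eq_AE) (use aeY XE_ev in \<open>auto elim!: eventually_mono\<close>)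
  finally show ?thesis .
qed

end

section \<open>Mixing\<close>

context noise
begin

section \<open>Noise on sets of small volume\<close>

text \<open>Turns sequential weak convergence at time 0 into a uniform statement: without such a
  \<open>d\<close>, some sequence of times tending to 0 would keep tails of mass at least
  \<open>e\<close>.\<close>

lemma law_tail_small:
  assumes e: "e > 0"
  shows "\<exists>d>0. \<forall>t. 0 \<le> t \<and> t < d \<longrightarrow> measure (\<mu>t t) {x. \<bar>x\<bar> > e} < e"
proof (rule ccontr)
  assume "\<not> ?thesis"
  then have "\<forall>n. \<exists>t. 0 \<le> t \<and> t < inverse (real (Suc n)) \<and> \<not> measure (\<mu>t t) {x. \<bar>x\<bar> > e} < e"
    by (meson inverse_positive_iff_positive of_nat_0_less_iff zero_less_Suc)
  then obtain t where t: "0 \<le> t n" "t n < inverse (real (Suc n))"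
    and large: "\<not> measure (\<mu>t (t n)) {x. \<bar>x\<bar> > e} < e" for n by metis
  \<comment> \<open>The law at time 0 is a point mass without tail, so the bad times approach 0
    strictly from the right, as \<open>law_continuous\<close> demands.\<close>
  have "t n \<noteq> 0" for n
  proof
    assume "t n = 0"
    then have "measure (\<mu>t (t n)) {x. \<bar>x\<bar> > e} = 0"
      using e by (simp add: law_zero measure_return)
    then show False using large[of n] e by simp
  qed
  then have pos: "0 < t n" for n using t(1)[of n] by (simp add: less_le)
  have "t \<longlonglongrightarrow> 0"
    using t by (intro tendsto_sandwich[OF _ _ tendsto_const LIMSEQ_inverse_real_of_nat])
      (auto intro!: always_eventually less_imp_le)
  then have "filterlim t (at_right 0) sequentially"
    using pos by (intro tendsto_imp_filterlim_at_right) auto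
  then have conv: "weak_conv_m (\<lambda>n. \<mu>t (t n)) (return borel 0)" by (rule law_continuous)
  interpret R: finite_borel_measure "return borel (0::real)"
    using prob_space_return[of "0::real" borel]
    by (intro finite_borel_measure.intro finite_borel_measure_axioms.intro prob_space.finite_measure) auto
  \<comment> \<open>The limit distribution function jumps only at 0, so convergence holds at
    \<open>- e\<close> and \<open>e\<close>, with limits 0 and 1.\<close>
  have "isCont (cdf (return borel 0)) x" if "x \<noteq> 0" for x :: real
    using that by (simp add: R.isCont_cdf measure_return)
  then have cdf: "(\<lambda>n. cdf (\<mu>t (t n)) x) \<longlonglongrightarrow> cdf (return borel 0) x" if "x \<noteq> 0" for x
    using conv that by (simp add: weak_conv_m_def weak_conv_def)
  have "(\<lambda>n. cdf (\<mu>t (t n)) (- e) + (1 - cdf (\<mu>t (t n)) e)) \<longlonglongrightarrow> 0 + (1 - 1)"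
    using cdf[of "- e"] cdf[of e] e
    by (intro tendsto_intros) (simp_all add: cdf_def measure_return)
  then have "\<forall>\<^sub>F n in sequentially. cdf (\<mu>t (t n)) (- e) + (1 - cdf (\<mu>t (t n)) e) < e"
    using e by (intro order_tendstoD) simp_all
  then obtain n where n: "cdf (\<mu>t (t n)) (- e) + (1 - cdf (\<mu>t (t n)) e) < e"
    by (auto simp: eventually_sequentially)
  interpret L: real_distribution "\<mu>t (t n)" using t(1) by (rule real_distribution_law)
  have "measure (\<mu>t (t n)) {x. \<bar>x\<bar> > e} \<le> measure (\<mu>t (t n)) ({..-e} \<union> (UNIV - {..e}))"
    by (intro L.finite_measure_mono) auto
  also have "\<dots> \<le> measure (\<mu>t (t n)) {..-e} + measure (\<mu>t (t n)) (UNIV - {..e})"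
    by (intro measure_Un_le) auto
  also have "measure (\<mu>t (t n)) (UNIV - {..e}) = 1 - measure (\<mu>t (t n)) {..e}"
    using L.prob_compl[of "{..e}"] by simp
  finally show False using n large[of n] by (simp add: cdf_def)
qed

lemma Xi_tail_small:
  assumes "e > 0"
  obtains d where "d > 0"
    "\<And>B. B \<in> finite_borel \<Longrightarrow> measure lborel B < d \<Longrightarrow> prob {\<omega> \<in> space P. \<bar>\<Xi> B \<omega>\<bar> > e} < e"
proof -
  obtain d where d: "d > 0" "\<And>t. 0 \<le> t \<Longrightarrow> t < d \<Longrightarrow> measure (\<mu>t t) {x. \<bar>x\<bar> > e} < e"
    using law_tail_small[OF assms] by auto
  have "prob {\<omega> \<in> space P. \<bar>\<Xi> B \<omega>\<bar> > e} < e" if B: "B \<in> finite_borel" "measure lborel B < d" for B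
  proof -
    have "prob {\<omega> \<in> space P. \<bar>\<Xi> B \<omega>\<bar> > e} = measure (distr P borel (\<Xi> B)) {x. \<bar>x\<bar> > e}"
      by (subst measure_distr[OF measurable_Xi[OF B(1)]]) (auto intro!: arg_cong[where f = prob])
    then show ?thesis using d(2)[of "measure lborel B"] B by (simp add: distr_Xi)
  qed
  with d(1) show ?thesis using that by blast
qed

lemma additive_Xi_Un:
  assumes "A \<in> finite_borel" "B \<in> finite_borel" "A \<inter> B = {}"
  shows "AE \<omega> in P. \<Xi> (A \<union> B) \<omega> = \<Xi> A \<omega> + \<Xi> B \<omega>"
  using additive_Xi[of "UNIV :: bool set" "\<lambda>b. if b then A else B"] assms
  by (auto simp: UNIV_bool disjoint_family_on_def Un_commute add.commute Int_commute)

text \<open>The error is the noise on \<open>B - C m\<close>, which tends to 0 in probability. Along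
  a subsequence with summable error probabilities, Borel--Cantelli upgrades this to almost sure
  convergence.\<close>

lemma AE_convergent_subseq:
  assumes B: "B \<in> finite_borel" and C: "\<And>m. C m \<in> finite_borel" "\<And>m. C m \<subseteq> B"
    and lim: "(\<lambda>m. measure lborel (B - C m)) \<longlonglongrightarrow> 0"
  obtains r :: "nat \<Rightarrow> nat" where "AE \<omega> in P. (\<lambda>k. \<Xi> (C (r k)) \<omega>) \<longlonglongrightarrow> \<Xi> B \<omega>"
proof -
  have diff: "B - C m \<in> finite_borel" for m
    using B C(1)[of m] by (intro finite_borel_subset[OF B]) (auto simp: finite_borel_def)
  have "\<exists>m. prob {\<omega> \<in> space P. \<bar>\<Xi> (B - C m) \<omega>\<bar> > (1/2)^k} < (1/2)^k" for k :: nat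
  proof -
    obtain d where "d > 0" and d: "\<And>A. A \<in> finite_borel \<Longrightarrow> measure lborel A < d \<Longrightarrow>
        prob {\<omega> \<in> space P. \<bar>\<Xi> A \<omega>\<bar> > (1/2)^k} < (1/2)^k"
      using Xi_tail_small[of "(1/2)^k"] by auto
    from \<open>d > 0\<close> have "\<forall>\<^sub>F m in sequentially. measure lborel (B - C m) < d"
      by (rule order_tendstoD(2)[OF lim])
    then show ?thesis using d diff by (auto simp: eventually_sequentially)
  qed
  then obtain r where r: "prob {\<omega> \<in> space P. \<bar>\<Xi> (B - C (r k)) \<omega>\<bar> > (1/2)^k} < (1/2)^k" for k
    by metis
  define E where "E k = {\<omega> \<in> space P. \<bar>\<Xi> (B - C (r k)) \<omega>\<bar> > (1/2)^k}" for k
  have E: "E k \<in> events" for k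
    using measurable_Xi[OF diff, measurable] unfolding E_def by measurable
  have "summable (\<lambda>k. prob (E k))"
    by (rule summable_comparison_test'[OF summable_geometric[of "1/2"]])
      (use r in \<open>auto simp: E_def less_imp_le\<close>)
  then have "AE \<omega> in P. \<forall>\<^sub>F k in sequentially. \<omega> \<in> space P - E k"
    by (intro borel_cantelli_AE1 E) (simp_all add: emeasure_eq_measure)
  moreover have "AE \<omega> in P. \<forall>k. \<Xi> B \<omega> = \<Xi> (C (r k)) \<omega> + \<Xi> (B - C (r k)) \<omega>"
    unfolding AE_all_countable
  proof
    fix k
    have "C (r k) \<union> (B - C (r k)) = B" using C(2) by blast
    then show "AE \<omega> in P. \<Xi> B \<omega> = \<Xi> (C (r k)) \<omega> + \<Xi> (B - C (r k)) \<omega>"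
      using additive_Xi_Un[OF C(1) diff, of "r k" "r k"] by auto
  qed
  ultimately have "AE \<omega> in P. (\<lambda>k. \<Xi> (C (r k)) \<omega>) \<longlonglongrightarrow> \<Xi> B \<omega>"
  proof eventually_elim
    fix \<omega> assume ev: "\<forall>\<^sub>F k in sequentially. \<omega> \<in> space P - E k"
      and sum: "\<forall>k. \<Xi> B \<omega> = \<Xi> (C (r k)) \<omega> + \<Xi> (B - C (r k)) \<omega>"
    have "\<Xi> (C (r k)) \<omega> - \<Xi> B \<omega> = - \<Xi> (B - C (r k)) \<omega>" for k
      using sum[rule_format, of k] by linarith
    then have "\<forall>\<^sub>F k in sequentially. norm (\<Xi> (C (r k)) \<omega> - \<Xi> B \<omega>) \<le> (1/2)^k"
      by (intro eventually_mono[OF ev]) (simp add: E_def not_less)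
    then have "(\<lambda>k. \<Xi> (C (r k)) \<omega> - \<Xi> B \<omega>) \<longlonglongrightarrow> 0"
      by (rule Lim_null_comparison) (intro LIMSEQ_power_zero, simp)
    then show "(\<lambda>k. \<Xi> (C (r k)) \<omega>) \<longlonglongrightarrow> \<Xi> B \<omega>" by (simp add: LIM_zero_iff)
  qed
  then show ?thesis by (rule that)
qed

lemma restrict_in_prod_emb_iff:
  assumes "J \<subseteq> I"
  shows "(\<lambda>i\<in>I. F i) \<in> prod_emb I (\<lambda>_. borel) J (Pi\<^sub>E J U) \<longleftrightarrow> (\<forall>i\<in>J. F i \<in> U i)"
proof -
  have "restrict (\<lambda>i\<in>I. F i) J = restrict F J"
    using assms by (auto simp: restrict_def fun_eq_iff)
  then show ?thesis by (auto simp: prod_emb_def PiE_iff space_PiM)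
qed

section \<open>The noise as a random element of the product space\<close>

lemma measurable_noise_map: "noise_map \<Xi> \<in> measurable P noise_space"
  unfolding noise_map_def[abs_def] noise_space_def by (intro measurable_restrict measurable_Xi)

lemma noise_shift_noise_map:
  assumes "preserves_lebesgue g"
  shows "noise_shift g (noise_map \<Xi> \<omega>) = (\<lambda>B\<in>finite_borel. \<Xi> (g -` B) \<omega>)"
  using assms by (auto simp: noise_shift_def noise_map_def preserves_lebesgue_def)

lemma measurable_noise_shift:
  assumes "preserves_lebesgue g"
  shows "(\<lambda>\<omega>. noise_shift g (noise_map \<Xi> \<omega>)) \<in> measurable P noise_space"
  unfolding noise_shift_noise_map[OF assms] noise_space_def
  using assms by (intro measurable_restrict measurable_Xi) (simp add: preserves_lebesgue_def)

text \<open>A finite measure on the product space is determined by its values on finite-dimensional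
  boxes, where \<open>prob_vimage_family\<close> gives equality.\<close>

lemma distr_noise_shift:
  assumes g: "preserves_lebesgue g"
  shows "distr P noise_space (\<lambda>\<omega>. noise_shift g (noise_map \<Xi> \<omega>)) = distr P noise_space (noise_map \<Xi>)"
proof (rule measure_eqI_PiM_infinite[where I = finite_borel and M = "\<lambda>_. borel"])
  show "finite_measure (distr P noise_space (\<lambda>\<omega>. noise_shift g (noise_map \<Xi> \<omega>)))"
    by (intro prob_space.finite_measure prob_space_distr measurable_noise_shift g)
  fix U and J :: "'a set set"
  assume J: "finite J" "J \<subseteq> finite_borel" and U: "\<And>B. B \<in> J \<Longrightarrow> U B \<in> sets (borel :: real measure)"
  let ?E = "prod_emb finite_borel (\<lambda>_. borel) J (Pi\<^sub>E J U)"
  have E: "?E \<in> sets noise_space" unfolding noise_space_def using J U by (intro sets_PiM_I) auto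
  have "(\<lambda>\<omega>. noise_shift g (noise_map \<Xi> \<omega>)) -` ?E \<inter> space P
      = {\<omega> \<in> space P. \<forall>B\<in>J. \<Xi> (g -` B) \<omega> \<in> U B}"
    using J by (auto simp: noise_shift_noise_map[OF g] restrict_in_prod_emb_iff)
  moreover have "noise_map \<Xi> -` ?E \<inter> space P = {\<omega> \<in> space P. \<forall>B\<in>J. \<Xi> B \<omega> \<in> U B}"
    using J by (auto simp: noise_map_def restrict_in_prod_emb_iff)
  moreover have "prob {\<omega> \<in> space P. \<forall>B\<in>J. \<Xi> (g -` B) \<omega> \<in> U B}
      = prob {\<omega> \<in> space P. \<forall>B\<in>J. \<Xi> B \<omega> \<in> U B}"
    using J U by (intro prob_vimage_family g) auto
  ultimately show "emeasure (distr P noise_space (\<lambda>\<omega>. noise_shift g (noise_map \<Xi> \<omega>))) ?E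
      = emeasure (distr P noise_space (noise_map \<Xi>)) ?E"
    by (simp add: emeasure_distr measurable_noise_map measurable_noise_shift g E emeasure_eq_measure)
qed (simp_all add: noise_space_def)

end

section \<open>Cylinder events\<close>

text \<open>Only coordinates in \<open>D\<close> may be tested. This allows \<open>D\<close> to be a
  class of sets that the shifts eventually separate.\<close>

definition cylinders :: "'a::euclidean_space set set \<Rightarrow> ('a set \<Rightarrow> real) set set" where
  "cylinders D = {{\<pi> \<in> space noise_space. \<forall>B\<in>J. \<pi> B \<in> U B} | J U.
     finite J \<and> J \<subseteq> D \<and> (\<forall>B\<in>J. U B \<in> sets borel)}"

lemma cylindersI:
  assumes "finite J" "J \<subseteq> D" "\<And>B. B \<in> J \<Longrightarrow> U B \<in> sets borel"
  shows "{\<pi> \<in> space noise_space. \<forall>B\<in>J. \<pi> B \<in> U B} \<in> cylinders D"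
  unfolding cylinders_def mem_Collect_eq using assms by (intro exI[of _ J] exI[of _ U]) simp

lemma cylindersE:
  assumes "S \<in> cylinders D"
  obtains J U where "S = {\<pi> \<in> space noise_space. \<forall>B\<in>J. \<pi> B \<in> U B}"
    "finite J" "J \<subseteq> D" "\<forall>B\<in>J. U B \<in> sets borel"
  using assms unfolding cylinders_def mem_Collect_eq by (elim exE conjE) (rule that)

lemma cylinders_subset_Pow: "cylinders D \<subseteq> Pow (space noise_space)"
  by (auto simp: cylinders_def)

lemma Int_stable_cylinders: "Int_stable (cylinders D)"
proof (rule Int_stableI)
  fix S T :: "('a set \<Rightarrow> real) set" assume "S \<in> cylinders D" "T \<in> cylinders D"
  obtain J U where S: "S = {\<pi> \<in> space noise_space. \<forall>B\<in>J. \<pi> B \<in> U B}"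
    "finite J" "J \<subseteq> D" "\<forall>B\<in>J. U B \<in> sets borel" using \<open>S \<in> _\<close> by (rule cylindersE)
  obtain K V where T: "T = {\<pi> \<in> space noise_space. \<forall>B\<in>K. \<pi> B \<in> V B}"
    "finite K" "K \<subseteq> D" "\<forall>B\<in>K. V B \<in> sets borel" using \<open>T \<in> _\<close> by (rule cylindersE)
  \<comment> \<open>\<open>UNIV\<close> stands in for the missing condition when a coordinate is
    tested by only one of the two cylinders.\<close>
  let ?W = "\<lambda>B. (if B \<in> J then U B else UNIV) \<inter> (if B \<in> K then V B else UNIV)"
  have "S \<inter> T = {\<pi> \<in> space noise_space. \<forall>B\<in>J \<union> K. \<pi> B \<in> ?W B}"
    unfolding S(1) T(1) by (auto split: if_splits)
  also have "\<dots> \<in> cylinders D" using S T by (intro cylindersI) auto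
  finally show "S \<inter> T \<in> cylinders D" .
qed

lemma cylinders_subset_sets:
  assumes "D \<subseteq> finite_borel"
  shows "cylinders D \<subseteq> sets noise_space"
proof
  fix S assume "S \<in> cylinders D"
  then obtain J U where S: "S = {\<pi> \<in> space noise_space. \<forall>B\<in>J. \<pi> B \<in> U B}"
    "finite J" "J \<subseteq> D" "\<forall>B\<in>J. U B \<in> sets borel" by (rule cylindersE)
  show "S \<in> sets noise_space" unfolding S(1)
  proof (intro sets.sets_Collect_finite_All S(2))
    fix B assume "B \<in> J"
    then have "(\<lambda>\<pi>. \<pi> B) \<in> measurable noise_space borel"
      unfolding noise_space_def using S(3) assms by (intro measurable_component_singleton) auto
    then show "{\<pi> \<in> space noise_space. \<pi> B \<in> U B} \<in> sets noise_space"
      using S(4) \<open>B \<in> J\<close> by (intro predE pred_sets2[where N = borel]) auto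
  qed
qed

lemma measurable_coordinate_cylinders:
  assumes "B \<in> D"
  shows "(\<lambda>\<pi>. \<pi> B) \<in> borel_measurable (sigma (space noise_space) (cylinders D))"
proof (rule measurableI)
  fix U :: "real set" assume "U \<in> sets borel"
  then have "{\<pi> \<in> space noise_space. \<forall>C\<in>{B}. \<pi> C \<in> U} \<in> cylinders D"
    using assms by (intro cylindersI) auto
  moreover have "(\<lambda>\<pi>. \<pi> B) -` U \<inter> space (sigma (space noise_space) (cylinders D))
      = {\<pi> \<in> space noise_space. \<forall>C\<in>{B}. \<pi> C \<in> U}"
    by (auto simp: space_measure_of_conv)
  ultimately show "(\<lambda>\<pi>. \<pi> B) -` U \<inter> space (sigma (space noise_space) (cylinders D))
      \<in> sets (sigma (space noise_space) (cylinders D))"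
    by (simp add: sets_measure_of[OF cylinders_subset_Pow])
qed simp

context noise
begin

text \<open>The sets that are almost surely equal to one generated by \<open>D\<close> form a \<open>\<sigma>\<close>-algebra.\<close>

lemma AE_eq_sigma_sets_cylinders:
  assumes D: "D \<subseteq> finite_borel"
    and dense: "\<And>B. B \<in> finite_borel \<Longrightarrow>
      \<exists>C. (\<forall>m::nat. C m \<in> D) \<and> (AE \<omega> in P. (\<lambda>m. \<Xi> (C m) \<omega>) \<longlonglongrightarrow> \<Xi> B \<omega>)"
    and S: "S \<in> sets noise_space"
  shows "\<exists>T \<in> sigma_sets (space noise_space) (cylinders D).
    AE \<omega> in P. noise_map \<Xi> \<omega> \<in> S \<longleftrightarrow> noise_map \<Xi> \<omega> \<in> T"
  using S unfolding noise_space_def sets_PiM_single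
proof (induction rule: sigma_sets.induct)
  case (Basic S)
  let ?N = "sigma (space noise_space) (cylinders D) :: ('a set \<Rightarrow> real) measure"
  from Basic obtain B U where S: "S = {\<pi> \<in> \<Pi>\<^sub>E B\<in>finite_borel. space borel. \<pi> B \<in> U}"
    and B: "B \<in> finite_borel" and U: "U \<in> sets (borel :: real measure)" by blast
  obtain C where C: "\<And>m::nat. C m \<in> D" "AE \<omega> in P. (\<lambda>m. \<Xi> (C m) \<omega>) \<longlonglongrightarrow> \<Xi> B \<omega>"
    using dense[OF B] by blast
  \<comment> \<open>The coordinate \<open>B\<close> is replaced by a limit of coordinates in
    \<open>D\<close>, which is measurable for the generated field. Where the limit fails to exist,
    \<open>lim\<close> is arbitrary, but this concerns only a null set of outcomes.\<close>
  let ?T = "{\<pi> \<in> space ?N. lim (\<lambda>m. \<pi> (C m)) \<in> U}"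
  have "(\<lambda>\<pi>. lim (\<lambda>m. \<pi> (C m))) \<in> borel_measurable ?N"
    by (intro borel_measurable_lim_metric measurable_coordinate_cylinders C(1))
  then have "?T \<in> sets ?N" using U by (intro predE pred_sets2[where N = borel])
  moreover have "AE \<omega> in P. noise_map \<Xi> \<omega> \<in> S \<longleftrightarrow> noise_map \<Xi> \<omega> \<in> ?T"
    using C(2)
  proof eventually_elim
    fix \<omega> assume "(\<lambda>m. \<Xi> (C m) \<omega>) \<longlonglongrightarrow> \<Xi> B \<omega>"
    moreover have "noise_map \<Xi> \<omega> (C m) = \<Xi> (C m) \<omega>" for m
      using C(1) D by (auto simp: noise_map_def)
    moreover have "noise_map \<Xi> \<omega> \<in> space noise_space"
      by (auto simp: noise_map_def noise_space_def space_PiM)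
    ultimately show "noise_map \<Xi> \<omega> \<in> S \<longleftrightarrow> noise_map \<Xi> \<omega> \<in> ?T"
      using B by (auto simp: S limI space_measure_of_conv noise_map_def)
  qed
  ultimately show ?case
    unfolding noise_space_def[symmetric]
    by (intro bexI[of _ ?T]) (simp_all add: sets_measure_of[OF cylinders_subset_Pow])
next
  case Empty
  then show ?case by (auto intro: sigma_sets.Empty)
next
  case (Compl S)
  then obtain T where T: "T \<in> sigma_sets (space noise_space) (cylinders D)"
    "AE \<omega> in P. noise_map \<Xi> \<omega> \<in> S \<longleftrightarrow> noise_map \<Xi> \<omega> \<in> T"
    unfolding noise_space_def by blast
  moreover have "noise_map \<Xi> \<omega> \<in> space noise_space" for \<omega>
    by (auto simp: noise_map_def noise_space_def space_PiM)
  ultimately have "AE \<omega> in P. noise_map \<Xi> \<omega> \<in> (\<Pi>\<^sub>E i\<in>finite_borel. space borel) - S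
      \<longleftrightarrow> noise_map \<Xi> \<omega> \<in> space noise_space - T"
    by (auto simp: noise_space_def space_PiM)
  with sigma_sets.Compl[OF T(1)] show ?case unfolding noise_space_def[symmetric] by blast
next
  case (Union S)
  have "\<forall>i. \<exists>T. T \<in> sigma_sets (space noise_space) (cylinders D) \<and>
      (AE \<omega> in P. noise_map \<Xi> \<omega> \<in> S i \<longleftrightarrow> noise_map \<Xi> \<omega> \<in> T)"
    using Union.IH unfolding noise_space_def Bex_def by (rule allI)
  from choice[OF this] obtain T where T: "\<And>i. T i \<in> sigma_sets (space noise_space) (cylinders D)"
    "\<And>i. AE \<omega> in P. noise_map \<Xi> \<omega> \<in> S i \<longleftrightarrow> noise_map \<Xi> \<omega> \<in> T i"
    by auto
  have "AE \<omega> in P. \<forall>i. noise_map \<Xi> \<omega> \<in> S i \<longleftrightarrow> noise_map \<Xi> \<omega> \<in> T i"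
    using T(2) by (simp add: AE_all_countable)
  then have "AE \<omega> in P. noise_map \<Xi> \<omega> \<in> (\<Union>i. S i) \<longleftrightarrow> noise_map \<Xi> \<omega> \<in> (\<Union>i. T i)"
    by eventually_elim simp
  with sigma_sets.Union[of T, OF T(1)] show ?case unfolding noise_space_def[symmetric] by blast
qed

end

section \<open>Mixing by a Dynkin argument\<close>

text \<open>The sets \<open>A\<close> with the asserted limit form a Dynkin system. Complements use
  the convergence of \<open>prob (E n)\<close>; disjoint unions use that all \<open>W n\<close> have
  the same law \<open>q\<close>. Both \<open>E\<close> and \<open>W\<close> may vary with
  \<open>n\<close>, so that the lemma can be applied to either factor of an intersection.\<close>

lemma (in prob_space) tendsto_prob_Int_sigma_sets:
  fixes W :: "nat \<Rightarrow> 'a \<Rightarrow> 'b" and q :: "'b set \<Rightarrow> real"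
  assumes G: "Int_stable G" "G \<subseteq> sets N"
    and W: "\<And>n. W n \<in> measurable M N" "\<And>n A. A \<in> sets N \<Longrightarrow> prob (W n -` A \<inter> space M) = q A"
    and E: "\<And>n. E n \<in> events" "(\<lambda>n. prob (E n)) \<longlonglongrightarrow> c"
    and basic: "\<And>A. A \<in> G \<Longrightarrow> (\<lambda>n. prob (E n \<inter> (W n -` A \<inter> space M))) \<longlonglongrightarrow> c * q A"
    and A: "A \<in> sigma_sets (space N) G"
  shows "(\<lambda>n. prob (E n \<inter> (W n -` A \<inter> space M))) \<longlonglongrightarrow> c * q A"
  using G(1) subset_trans[OF G(2) sets.space_closed] A
proof (induction rule: sigma_sets_induct_disjoint)
  case (basic A)
  then show ?case by (rule assms)
next
  case empty
  have "q {} = 0" using W(2)[of "{}" 0] by simp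
  then show ?case by simp
next
  case (compl A)
  have A: "A \<in> sets N" using compl(1) sets.sigma_sets_subset[OF G(2)] by blast
  have ev: "W n -` A \<inter> space M \<in> events" for n using W(1) A by (rule measurable_sets)
  have vimage: "W n -` (space N - A) \<inter> space M = space M - (W n -` A \<inter> space M)" for n
    using measurable_space[OF W(1)] by auto
  have "E n \<inter> (W n -` (space N - A) \<inter> space M) = E n - E n \<inter> (W n -` A \<inter> space M)" for n
    unfolding vimage using sets.sets_into_space[OF E(1)] by blast
  then have diff: "prob (E n \<inter> (W n -` (space N - A) \<inter> space M)) = prob (E n) - prob (E n \<inter> (W n -` A \<inter> space M))" for n
    using E(1) ev by (simp add: finite_measure_Diff)
  have q: "q (space N - A) = 1 - q A"
    using W(2)[of "space N - A" 0] W(2)[OF A, of 0] A prob_compl[OF ev[of 0]] unfolding vimage by simp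
  show ?case
    unfolding diff q right_diff_distrib mult_1_right by (rule tendsto_diff[OF E(2) compl(2)])
next
  case (union A)
  have A: "A k \<in> sets N" for k using union(2) sets.sigma_sets_subset[OF G(2)] by blast
  have ev: "W n -` A k \<inter> space M \<in> events" for n k using W(1) A by (rule measurable_sets)
  have disj: "disjoint_family (\<lambda>k. W n -` A k \<inter> space M)" for n
    using union(1) by (auto simp: disjoint_family_on_def)
  have "(\<lambda>k. prob (W 0 -` A k \<inter> space M)) sums prob (\<Union>k. W 0 -` A k \<inter> space M)"
    using ev disj by (intro finite_measure_UNION) auto
  moreover have "(\<Union>k. W n -` A k \<inter> space M) = W n -` (\<Union>k. A k) \<inter> space M" for n by auto
  ultimately have q: "(\<lambda>k. q (A k)) sums q (\<Union>k. A k)"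
    using A by (simp add: W(2))
  have sums: "(\<lambda>k. prob (E n \<inter> (W n -` A k \<inter> space M))) sums prob (E n \<inter> (W n -` (\<Union>k. A k) \<inter> space M))" for n
  proof -
    have "(\<lambda>k. prob (E n \<inter> (W n -` A k \<inter> space M))) sums prob (\<Union>k. E n \<inter> (W n -` A k \<inter> space M))"
    proof (rule finite_measure_UNION)
      show "disjoint_family (\<lambda>k. E n \<inter> (W n -` A k \<inter> space M))"
        using disj[of n] unfolding disjoint_family_on_def by blast
    qed (use ev E(1) in auto)
    also have "(\<Union>k. E n \<inter> (W n -` A k \<inter> space M)) = E n \<inter> (W n -` (\<Union>k. A k) \<inter> space M)" by auto
    finally show ?thesis .
  qed
  have bound: "norm (prob (E n \<inter> (W n -` A k \<inter> space M))) \<le> q (A k)" for n k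
  proof -
    have "prob (E n \<inter> (W n -` A k \<inter> space M)) \<le> prob (W n -` A k \<inter> space M)"
      by (intro finite_measure_mono ev) auto
    then show ?thesis by (simp add: W(2)[OF A])
  qed
  \<comment> \<open>Limit and sum may be exchanged because the summable terms \<open>q (A k)\<close>
    dominate uniformly in \<open>n\<close>.\<close>
  have "(\<lambda>n. \<Sum>k. prob (E n \<inter> (W n -` A k \<inter> space M))) \<longlonglongrightarrow> (\<Sum>k. c * q (A k))"
    using tannerys_theorem[of "\<lambda>k n. prob (E n \<inter> (W n -` A k \<inter> space M))" "\<lambda>k. c * q (A k)" sequentially "\<lambda>k. q (A k)"]
      union(3) bound sums_summable[OF q] by (simp add: always_eventually)
  then show ?case
    using sums_unique[OF sums] sums_unique[OF q] suminf_mult[OF sums_summable[OF q], of c] by simp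
qed

context noise
begin

lemma mixing_zero_one:
  assumes g: "\<And>n. preserves_lebesgue (g n)"
    and D: "D \<subseteq> finite_borel"
    and sep: "\<And>B C. B \<in> D \<Longrightarrow> C \<in> D \<Longrightarrow> \<forall>\<^sub>F n in sequentially. B \<inter> g n -` C = {}"
    and dense: "\<And>B. B \<in> finite_borel \<Longrightarrow>
      \<exists>C. (\<forall>m::nat. C m \<in> D) \<and> (AE \<omega> in P. (\<lambda>m. \<Xi> (C m) \<omega>) \<longlonglongrightarrow> \<Xi> B \<omega>)"
    and S: "S \<in> sets noise_space"
    and inv: "\<And>n. AE \<omega> in P. noise_map \<Xi> \<omega> \<in> S \<longleftrightarrow> noise_shift (g n) (noise_map \<Xi> \<omega>) \<in> S"
  shows "prob {\<omega> \<in> space P. noise_map \<Xi> \<omega> \<in> S} \<in> {0, 1}"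
proof -
  let ?X = "noise_map \<Xi>" and ?Y = "\<lambda>n \<omega>. noise_shift (g n) (noise_map \<Xi> \<omega>)"
  let ?q = "\<lambda>A. prob (?X -` A \<inter> space P)"
  have X: "?X \<in> measurable P noise_space" by (rule measurable_noise_map)
  have Y: "?Y n \<in> measurable P noise_space" for n by (rule measurable_noise_shift[OF g])
  have qY: "prob (?Y n -` A \<inter> space P) = ?q A" if "A \<in> sets noise_space" for n A
    using distr_noise_shift[OF g, of n] measure_distr[OF X that] measure_distr[OF Y that, of n] by simp
  note G = Int_stable_cylinders[of D] cylinders_subset_sets[OF D]
  have basic: "(\<lambda>n. prob ((?X -` A \<inter> space P) \<inter> (?Y n -` B \<inter> space P))) \<longlonglongrightarrow> ?q A * ?q B"
    if A: "A \<in> cylinders D" and B: "B \<in> cylinders D" for A B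
  proof -
    obtain J U where A': "A = {\<pi> \<in> space noise_space. \<forall>B\<in>J. \<pi> B \<in> U B}"
      "finite J" "J \<subseteq> D" "\<forall>B\<in>J. U B \<in> sets borel" using A by (rule cylindersE)
    obtain K V where B': "B = {\<pi> \<in> space noise_space. \<forall>B\<in>K. \<pi> B \<in> V B}"
      "finite K" "K \<subseteq> D" "\<forall>B\<in>K. V B \<in> sets borel" using B by (rule cylindersE)
    have XA: "?X -` A \<inter> space P = {\<omega> \<in> space P. \<forall>B\<in>J. \<Xi> B \<omega> \<in> U B}"
      using A'(3) D by (auto simp: A'(1) noise_map_def noise_space_def space_PiM)
    have YB: "?Y n -` B \<inter> space P = {\<omega> \<in> space P. \<forall>C\<in>K. \<Xi> (g n -` C) \<omega> \<in> V C}" for n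
      using B'(3) D by (auto simp: B'(1) noise_shift_noise_map[OF g] noise_space_def space_PiM)
    \<comment> \<open>Only finitely many pairs of sets occur, so all are disjoint from some
      \<open>n\<close> on, and the product formula is then exact.\<close>
    have "\<forall>\<^sub>F n in sequentially. \<forall>B\<in>J. \<forall>C\<in>K. B \<inter> g n -` C = {}"
      by (intro eventually_ball_finite ballI sep) (use A' B' in auto)
    then have "\<forall>\<^sub>F n in sequentially.
        prob ((?X -` A \<inter> space P) \<inter> (?Y n -` B \<inter> space P)) = ?q A * ?q B"
    proof eventually_elim
      case (elim n)
      have "prob ((?X -` A \<inter> space P) \<inter> (?Y n -` B \<inter> space P))
          = prob {\<omega> \<in> space P. (\<forall>B\<in>J. \<Xi> B \<omega> \<in> U B) \<and> (\<forall>C\<in>K. \<Xi> (g n -` C) \<omega> \<in> V C)}"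
        unfolding XA YB by (rule arg_cong[where f = prob]) auto
      also have "\<dots> = prob (?X -` A \<inter> space P) * prob (?Y n -` B \<inter> space P)"
        unfolding XA YB
      proof (rule prob_disjoint_families)
        fix C assume "C \<in> K"
        then show "g n -` C \<in> finite_borel" using g[of n] B'(3) D by (auto simp: preserves_lebesgue_def)
      qed (use A' B' D elim in auto)
      also have "prob (?Y n -` B \<inter> space P) = ?q B" using B G(2) by (intro qY) auto
      finally show ?case .
    qed
    then show ?thesis by (rule tendsto_eventually)
  qed
  have sets: "A \<in> sets noise_space" if "A \<in> sigma_sets (space noise_space) (cylinders D)" for A
    using that sets.sigma_sets_subset[OF G(2)] by blast
  \<comment> \<open>The shifted event is generalized first, with the unshifted cylinder
    fixed.\<close>
  have mix1: "(\<lambda>n. prob ((?X -` A \<inter> space P) \<inter> (?Y n -` B \<inter> space P))) \<longlonglongrightarrow> ?q A * ?q B"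
    if A: "A \<in> cylinders D" and B: "B \<in> sigma_sets (space noise_space) (cylinders D)" for A B
  proof (rule tendsto_prob_Int_sigma_sets[OF G, where W = ?Y and E = "\<lambda>_. ?X -` A \<inter> space P"])
    show "(\<lambda>n. prob ((?X -` A \<inter> space P) \<inter> (?Y n -` B \<inter> space P))) \<longlonglongrightarrow> ?q A * ?q B"
      if "B \<in> cylinders D" for B
      using basic[OF A that] .
    show "?X -` A \<inter> space P \<in> events" using A G(2) by (intro measurable_sets[OF X]) auto
  qed (use Y qY B in simp_all)
  \<comment> \<open>Now the unshifted event is generalized: the shifted event takes the part of the
    varying \<open>E n\<close>, and \<open>W\<close> is constant.\<close>
  have mix2: "(\<lambda>n. prob ((?Y n -` B \<inter> space P) \<inter> (?X -` A \<inter> space P))) \<longlonglongrightarrow> ?q B * ?q A"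
    if A: "A \<in> sigma_sets (space noise_space) (cylinders D)"
      and B: "B \<in> sigma_sets (space noise_space) (cylinders D)" for A B
  proof (rule tendsto_prob_Int_sigma_sets[OF G, where W = "\<lambda>_. ?X" and E = "\<lambda>n. ?Y n -` B \<inter> space P"])
    show "(\<lambda>n. prob (?Y n -` B \<inter> space P)) \<longlonglongrightarrow> ?q B" using qY[OF sets[OF B]] by simp
    show "(\<lambda>n. prob ((?Y n -` B \<inter> space P) \<inter> (?X -` A \<inter> space P))) \<longlonglongrightarrow> ?q B * ?q A"
      if "A \<in> cylinders D" for A
      using mix1[OF that B] by (simp add: Int_commute mult.commute)
  qed (use X A measurable_sets[OF Y sets[OF B]] in auto)
  obtain T where T: "T \<in> sigma_sets (space noise_space) (cylinders D)"
    "AE \<omega> in P. ?X \<omega> \<in> S \<longleftrightarrow> ?X \<omega> \<in> T"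
    using AE_eq_sigma_sets_cylinders[OF D dense S] by blast
  note T_sets = sets[OF T(1)]
  \<comment> \<open>Agreement of \<open>S\<close> and \<open>T\<close> up to null sets is a property
    of the law of the noise, which the shift preserves.\<close>
  have "AE \<omega> in P. ?Y n \<omega> \<in> S \<longleftrightarrow> ?Y n \<omega> \<in> T" for n
  proof -
    have "AE \<pi> in distr P noise_space ?X. \<pi> \<in> S \<longleftrightarrow> \<pi> \<in> T"
      using T(2) S T_sets by (subst AE_distr_iff[OF X]) (auto intro!: predE)
    then have "AE \<pi> in distr P noise_space (?Y n). \<pi> \<in> S \<longleftrightarrow> \<pi> \<in> T"
      by (simp only: distr_noise_shift[OF g])
    then show ?thesis by (rule AE_distrD[OF Y])
  qed
  then have "AE \<omega> in P. ?Y n \<omega> \<in> T \<longleftrightarrow> ?X \<omega> \<in> T" for n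
    using T(2) inv[of n] by eventually_elim blast
  then have "AE \<omega> in P. \<omega> \<in> (?Y n -` T \<inter> space P) \<inter> (?X -` T \<inter> space P) \<longleftrightarrow> \<omega> \<in> ?X -` T \<inter> space P" for n
    by (rule eventually_mono) auto
  then have "prob ((?Y n -` T \<inter> space P) \<inter> (?X -` T \<inter> space P)) = ?q T" for n
    by (rule measure_eq_AE) (use measurable_sets[OF X T_sets] measurable_sets[OF Y T_sets] in blast)+
  \<comment> \<open>By invariance the sequence in \<open>mix2\<close> is constant, so its value
    equals its limit.\<close>
  with mix2[OF T(1) T(1)] have "?q T = ?q T * ?q T"
    by (simp add: LIMSEQ_const_iff)
  then have "?q T \<in> {0, 1}" by auto
  moreover have "prob {\<omega> \<in> space P. ?X \<omega> \<in> S} = ?q T"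
  proof (rule measure_eq_AE)
    have "{\<omega> \<in> space P. ?X \<omega> \<in> S} = ?X -` S \<inter> space P" by auto
    then show "{\<omega> \<in> space P. ?X \<omega> \<in> S} \<in> events" using measurable_sets[OF X S] by simp
  qed (use T(2) measurable_sets[OF X T_sets] in \<open>auto elim!: eventually_mono\<close>)
  ultimately show ?thesis by simp
qed

end

section \<open>The zero-one law\<close>

text \<open>Monotonicity forces a single jump from 0 to 1, at the infimum \<open>c\<close> of the
  points with value 1. Right continuity settles the value at \<open>c\<close>, and the distribution
  function determines the law.\<close>

lemma (in real_distribution) zero_one_cdf_imp_return:
  assumes "\<And>x. cdf M x \<in> {0, 1}"
  shows "\<exists>c. M = return borel c"
proof -
  define A where "A = {x. cdf M x = 1}"
  define c where "c = Inf A"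
  have "\<forall>\<^sub>F x in at_top. cdf M x > 0"
    by (rule order_tendstoD(1)[OF cdf_lim_at_top_prob]) simp
  then obtain a where "cdf M a > 0" by (auto simp: eventually_at_top_linorder)
  then have "a \<in> A" using assms[of a] by (auto simp: A_def)
  have "\<forall>\<^sub>F x in at_bot. cdf M x < 1"
    by (rule order_tendstoD(2)[OF cdf_lim_at_bot]) simp
  then obtain y where y: "\<And>x. x \<le> y \<Longrightarrow> cdf M x < 1"
    by (auto simp: eventually_at_bot_linorder)
  have "y \<le> x" if "x \<in> A" for x
    using y[of x] that by (cases "x \<le> y") (auto simp: A_def)
  then have bdd: "bdd_below A" by (rule bdd_belowI)
  have above: "cdf M x = 1" if "c < x" for x
  proof -
    have "A \<noteq> {}" "Inf A < x" using that \<open>a \<in> A\<close> by (auto simp: c_def)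
    from cInf_lessD[OF this] obtain a' where "a' \<in> A" "a' < x" by blast
    then show ?thesis using cdf_nondecreasing[of a' x] assms[of x] by (auto simp: A_def)
  qed
  have below: "cdf M x = 0" if "x < c" for x
    using that assms[of x] cInf_lower[OF _ bdd, of x] by (auto simp: A_def c_def)
  have "(cdf M \<longlongrightarrow> 1) (at_right c)"
    by (rule tendsto_eventually) (auto simp: eventually_at_filter above)
  moreover have "(cdf M \<longlongrightarrow> cdf M c) (at_right c)"
    using cdf_is_right_cont[of c] by (simp add: continuous_within)
  ultimately have "cdf M c = 1"
    using tendsto_unique[OF trivial_limit_at_right_real] by blast
  have "cdf M x = cdf (return borel c) x" for x
  proof -
    have "cdf (return borel c) x = (if c \<le> x then 1 else 0)"
      by (simp add: cdf_def measure_return)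
    then show ?thesis
      using above[of x] below[of x] \<open>cdf M c = 1\<close> by (cases x c rule: linorder_cases) simp_all
  qed
  then have "cdf M = cdf (return borel c)" by (rule ext)
  moreover have "real_distribution (return borel c)"
    using prob_space_return[of c borel]
    by (simp add: real_distribution_def real_distribution_axioms_def)
  ultimately show ?thesis
    using cdf_unique real_distribution_axioms by blast
qed

section \<open>Compact groups: a nontrivial invariant event\<close>

lemma closed_unimodular: "closed {A::real^'n^'n. \<bar>det A\<bar> = 1}"
  unfolding det_def by (intro closed_Collect_eq continuous_intros)

lemma subgroup_unimodularD:
  fixes G :: "(real^'n^'n) set"
  assumes "subgroup G unimodular_group"
  shows "\<And>A. A \<in> G \<Longrightarrow> \<bar>det A\<bar> = 1" "mat 1 \<in> G" "\<And>A B. A \<in> G \<Longrightarrow> B \<in> G \<Longrightarrow> A ** B \<in> G"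
    "\<And>A. A \<in> G \<Longrightarrow> \<exists>A'\<in>G. A' ** A = mat 1"
proof -
  interpret G: subgroup G unimodular_group by fact
  note unimodular_group_def [simp]
  show "\<bar>det A\<bar> = 1" if "A \<in> G" for A using G.mem_carrier[OF that] by simp
  show "mat 1 \<in> G" using G.one_closed by simp
  show "A ** B \<in> G" if "A \<in> G" "B \<in> G" for A B using G.m_closed[OF that] by simp
  show "\<exists>A'\<in>G. A' ** A = mat 1" if "A \<in> G" for A
    using G.m_inv_closed[OF that] group.l_inv[OF group_unimodular_group G.mem_carrier[OF that]]
    by auto
qed

text \<open>The orbit \<open>K\<close> of the unit ball is compact, hence of finite volume, and
  contains the ball, hence of positive volume. Scaling to volume 1 commutes with the matrices in
  \<open>G\<close>.\<close>

lemma invariant_set_of_compact_group: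
  fixes G :: "(real^'n^'n) set"
  assumes G: "subgroup G unimodular_group" and "compact G"
  obtains B :: "(real^'n) set" where "B \<in> finite_borel" "measure lborel B = 1"
    "\<And>A. A \<in> G \<Longrightarrow> (*v) A -` B = B"
proof -
  define K where "K = (\<lambda>p. fst p *v snd p) ` (G \<times> cball (0::real^'n) 1)"
  have "continuous_on (G \<times> cball (0::real^'n) 1) (\<lambda>p. fst p *v snd p)"
    unfolding matrix_vector_mult_def by (intro continuous_intros)
  then have "compact K"
    unfolding K_def by (intro compact_continuous_image compact_Times \<open>compact G\<close>) auto
  then have K: "K \<in> lmeasurable" by (rule lmeasurable_compact)
  have "cball 0 1 \<subseteq> K"
  proof
    fix x :: "real^'n" assume "x \<in> cball 0 1"
    then show "x \<in> K" unfolding K_def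
      by (intro image_eqI[of _ _ "(mat 1, x)"]) (use subgroup_unimodularD(2)[OF G] in auto)
  qed
  then have "measure lebesgue (cball (0::real^'n) 1) \<le> measure lebesgue K"
    by (intro measure_mono_fmeasurable K) auto
  moreover have "measure lebesgue (cball (0::real^'n) 1) > 0"
    using content_cball_pos[of 1 "0::real^'n"] by simp
  ultimately have pos: "measure lebesgue K > 0" by linarith
  \<comment> \<open>Scaling by \<open>r\<close> multiplies volume by
    \<open>r ^ CARD('n)\<close>.\<close>
  define r where "r = root CARD('n) (1 / measure lebesgue K)"
  have r: "r > 0" "r ^ CARD('n) * measure lebesgue K = 1"
    using pos by (simp_all add: r_def)
  define B where "B = (\<lambda>x. r *\<^sub>R x) ` K"
  have "compact B" unfolding B_def using \<open>compact K\<close> by (rule compact_scaling)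
  then have B: "B \<in> sets borel" "B \<in> lmeasurable"
    by (auto simp: lmeasurable_compact compact_imp_closed)
  have sub: "A *v x \<in> B" if "A \<in> G" "x \<in> B" for A x
  proof -
    from \<open>x \<in> B\<close> obtain C y where C: "C \<in> G" "y \<in> cball 0 1" "x = r *\<^sub>R (C *v y)"
      by (auto simp: B_def K_def)
    then have "A *v x = r *\<^sub>R ((A ** C) *v y)"
      by (simp add: matrix_vector_mul_assoc[symmetric] matrix_vector_mult_scaleR)
    moreover have "(A ** C) *v y \<in> K" unfolding K_def
      by (intro image_eqI[of _ _ "(A ** C, y)"]) (use C that subgroup_unimodularD(3)[OF G] in auto)
    ultimately show ?thesis unfolding B_def by blast
  qed
  have "(*v) A -` B = B" if A: "A \<in> G" for A
  proof (intro equalityI subsetI)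
    fix x assume "x \<in> (*v) A -` B"
    \<comment> \<open>The inverse matrix lies in \<open>G\<close> too, which improves the inclusion
      \<open>sub\<close> to equality of \<open>B\<close> and its preimage.\<close>
    moreover obtain A' where A': "A' \<in> G" "A' ** A = mat 1"
      using subgroup_unimodularD(4)[OF G A] by blast
    ultimately have "A' *v (A *v x) \<in> B" using sub by auto
    then show "x \<in> B" by (simp add: matrix_vector_mul_assoc A')
  qed (use sub A in auto)
  moreover have "measure lborel B = 1"
    using measure_lebesgue_affine[of r 0 K] r B by (simp add: B_def)
  ultimately show ?thesis using B that by (auto simp: finite_borel_iff_lmeasurable)
qed

context noise
begin

lemma nontrivial_invariant_set:
  assumes B: "B \<in> finite_borel" "\<And>g. g \<in> H \<Longrightarrow> g -` B = B"
    and nondeg: "\<nexists>c. \<mu>t (measure lborel B) = return borel c"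
  shows "\<exists>S\<in>invariant_sigma_field P \<Xi> H. prob {\<omega> \<in> space P. noise_map \<Xi> \<omega> \<in> S} \<notin> {0, 1}"
proof -
  let ?\<nu> = "\<mu>t (measure lborel B)"
  interpret \<nu>: real_distribution ?\<nu> by (rule real_distribution_law) simp
  obtain a where a: "cdf ?\<nu> a \<notin> {0, 1}"
    using \<nu>.zero_one_cdf_imp_return nondeg by blast
  define S where "S = {\<pi> \<in> space noise_space. \<forall>C\<in>{B}. \<pi> C \<in> {..a}}"
  have "S \<in> cylinders {B}" unfolding S_def by (intro cylindersI) auto
  then have S: "S \<in> sets noise_space" using cylinders_subset_sets[of "{B}"] B by auto
  have "{\<omega> \<in> space P. noise_shift g (noise_map \<Xi> \<omega>) \<in> S} = {\<omega> \<in> space P. noise_map \<Xi> \<omega> \<in> S}"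
    if "g \<in> H" for g
    using B that by (auto simp: S_def noise_shift_def noise_map_def noise_space_def space_PiM)
  then have "S \<in> invariant_sigma_field P \<Xi> H"
    using S by (simp add: invariant_sigma_field_def)
  moreover have "{\<omega> \<in> space P. noise_map \<Xi> \<omega> \<in> S} = \<Xi> B -` {..a} \<inter> space P"
    using B by (auto simp: S_def noise_map_def noise_space_def space_PiM)
  then have "prob {\<omega> \<in> space P. noise_map \<Xi> \<omega> \<in> S} = cdf ?\<nu> a"
    using measure_distr[OF measurable_Xi[OF B(1)], of "{..a}"] by (simp add: distr_Xi B(1) cdf_def)
  ultimately show ?thesis using a by (intro bexI[of _ S]) simp_all
qed

section \<open>Noncompact groups: the zero-one law\<close>

lemma zero_one_of_summable_overlaps:
  assumes g: "\<And>n. preserves_lebesgue (g n)"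
    and overlap: "\<And>n::nat. measure lborel (cball 0 (real n) \<inter> g n -` cball 0 (real n)) < (1/2)^n"
    and S: "S \<in> sets noise_space"
    and inv: "\<And>n. AE \<omega> in P. noise_map \<Xi> \<omega> \<in> S \<longleftrightarrow> noise_shift (g n) (noise_map \<Xi> \<omega>) \<in> S"
  shows "prob {\<omega> \<in> space P. noise_map \<Xi> \<omega> \<in> S} \<in> {0, 1}"
proof -
  let ?V = "\<lambda>n. g n -` cball 0 (real n)"
  \<comment> \<open>For \<open>B\<close> and \<open>C\<close> in \<open>D\<close> and large
    \<open>n\<close>, \<open>C\<close> lies in the ball of radius \<open>n\<close>, whose preimage
    misses \<open>B\<close>; this is the separation that \<open>mixing_zero_one\<close>
    requires.\<close>
  define D where "D = {B \<in> finite_borel. \<exists>m. B \<subseteq> cball 0 (real m) \<and> (\<forall>n\<ge>m. B \<inter> ?V n = {})}"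
  have cball: "cball (0::'a) (real n) \<in> finite_borel" for n
    using emeasure_bounded_finite[of "cball (0::'a) (real n)"] by (auto simp: finite_borel_def less_top)
  have "?V n \<in> finite_borel" for n
    using g[of n] cball by (simp add: preserves_lebesgue_def)
  then have V: "?V n \<in> sets borel" for n by (simp add: finite_borel_def)
  define N where "N n = cball 0 (real n) \<inter> ?V n" for n
  have N: "N n \<in> finite_borel" for n
    unfolding N_def by (intro finite_borel_subset[OF cball]) (auto intro: V)
  have "summable (\<lambda>n. measure lborel (N n))"
    by (rule summable_comparison_test'[OF summable_geometric[of "1/2"]])
      (use overlap in \<open>auto simp: N_def less_imp_le\<close>)
  then have null: "AE x in lborel. \<forall>\<^sub>F n in sequentially. x \<notin> N n"
    using borel_cantelli_AE1[of N lborel] N by (auto simp: finite_borel_def)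
  show ?thesis
  proof (rule mixing_zero_one[where g = g and D = D])
    show "D \<subseteq> finite_borel" by (auto simp: D_def)
    fix B C assume "B \<in> D" "C \<in> D"
    then obtain m m' where m: "\<And>n. n \<ge> m \<Longrightarrow> B \<inter> ?V n = {}" and m': "C \<subseteq> cball 0 (real m')"
      unfolding D_def by blast
    show "\<forall>\<^sub>F n in sequentially. B \<inter> g n -` C = {}"
      using eventually_ge_at_top[of "max m m'"]
    proof eventually_elim
      case (elim n)
      then have "C \<subseteq> cball 0 (real n)" using m' by (auto intro: order_trans)
      moreover have "B \<inter> ?V n = {}" using elim by (intro m) simp
      ultimately show ?case by blast
    qed
  next
    fix B :: "'a set" assume B: "B \<in> finite_borel"
    \<comment> \<open>Cutting to the ball and removing all later preimages puts \<open>C m\<close>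
      into \<open>D\<close> with threshold \<open>m\<close>.\<close>
    define C where "C m = B \<inter> cball 0 (real m) - (\<Union>n\<in>{m..}. ?V n)" for m
    have C_sets: "C m \<in> sets borel" for m
      using B V by (auto simp: C_def finite_borel_def)
    then have C_fin: "C m \<in> finite_borel" for m
      by (intro finite_borel_subset[OF B]) (auto simp: C_def)
    have C_mono: "C m \<subseteq> C n" if "m \<le> n" for m n
      using that by (force simp: C_def)
    have "(\<lambda>m. measure lborel (B - C m)) \<longlonglongrightarrow> measure lborel (\<Inter>m. B - C m)"
    proof (rule Lim_measure_decseq)
      show "range (\<lambda>m. B - C m) \<subseteq> sets lborel" using B C_sets by (auto simp: finite_borel_def)
      show "decseq (\<lambda>m. B - C m)" using C_mono by (intro decseq_def[THEN iffD2]) blast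
      show "emeasure lborel (B - C m) \<noteq> \<infinity>" for m
        using finite_borel_subset[OF B, of "B - C m"] B C_sets by (auto simp: finite_borel_def)
    qed
    \<comment> \<open>A point of \<open>B\<close> in no \<open>C m\<close> lies in infinitely many
      \<open>?V n\<close>. It also lies in every ball of large radius, hence in infinitely many
      \<open>N n\<close>, which Borel--Cantelli confines to a null set.\<close>
    also have "measure lborel (\<Inter>m. B - C m) = measure lborel ({} :: 'a set)"
    proof (rule measure_eq_AE)
      show "AE x in lborel. x \<in> (\<Inter>m. B - C m) \<longleftrightarrow> x \<in> {}"
        using null
      proof eventually_elim
        case (elim x)
        then obtain k where k: "\<And>n. n \<ge> k \<Longrightarrow> x \<notin> N n" by (auto simp: eventually_sequentially)
        obtain j :: nat where j: "norm x \<le> real j" using real_arch_simple by blast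
        have "x \<in> C (max k j)" if "x \<in> B"
        proof -
          have "x \<notin> ?V n" if "n \<ge> max k j" for n
          proof -
            have "x \<in> cball 0 (real n)" using j that by auto
            then show ?thesis using k[of n] that by (auto simp: N_def)
          qed
          then show ?thesis using that j by (auto simp: C_def)
        qed
        then show ?case by auto
      qed
      show "(\<Inter>m. B - C m) \<in> sets lborel" using B C_sets by (auto simp: finite_borel_def)
    qed simp
    finally have lim: "(\<lambda>m. measure lborel (B - C m)) \<longlonglongrightarrow> 0" by simp
    obtain r :: "nat \<Rightarrow> nat" where r: "AE \<omega> in P. (\<lambda>k. \<Xi> (C (r k)) \<omega>) \<longlonglongrightarrow> \<Xi> B \<omega>"
      by (rule AE_convergent_subseq[OF B C_fin _ lim]) (auto simp: C_def)
    have "C m \<in> D" for m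
      unfolding D_def using C_fin by (auto simp: C_def intro!: exI[of _ m])
    with r show "\<exists>C. (\<forall>m::nat. C m \<in> D) \<and> (AE \<omega> in P. (\<lambda>m. \<Xi> (C m) \<omega>) \<longlonglongrightarrow> \<Xi> B \<omega>)"
      by (intro exI[of _ "\<lambda>k. C (r k)"]) simp
  qed fact+
qed

lemma AE_of_invariant_sigma_field:
  assumes "S \<in> invariant_sigma_field P \<Xi> H" "g \<in> H" and g: "preserves_lebesgue g"
  shows "AE \<omega> in P. noise_map \<Xi> \<omega> \<in> S \<longleftrightarrow> noise_shift g (noise_map \<Xi> \<omega>) \<in> S"
proof -
  let ?X = "{\<omega> \<in> space P. noise_map \<Xi> \<omega> \<in> S}"
  let ?Y = "{\<omega> \<in> space P. noise_shift g (noise_map \<Xi> \<omega>) \<in> S}"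
  have S: "S \<in> sets noise_space" and zero: "prob (sym_diff ?X ?Y) = 0"
    using assms(1,2) by (auto simp: invariant_sigma_field_def)
  have "?X \<in> events" "?Y \<in> events"
    using measurable_sets[OF measurable_noise_map S] measurable_sets[OF measurable_noise_shift[OF g] S]
    by (simp_all add: vimage_def Int_def conj_commute)
  then have "AE \<omega> in P. \<omega> \<notin> sym_diff ?X ?Y"
    using zero by (subst prob_eq_0[symmetric]) auto
  then show ?thesis by (rule AE_mp) (auto intro!: AE_I2)
qed

end

lemma levy_noise_imp_noise:
  fixes \<Xi> :: "'a::euclidean_space set \<Rightarrow> 'w \<Rightarrow> real"
  assumes "levy_noise P \<mu> \<Xi>"
  obtains \<mu>t where "noise P \<mu>t \<Xi>" "\<mu>t 1 = \<mu>"
proof -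
  interpret prob_space P using assms by (simp add: levy_noise_def)
  obtain \<mu>t where \<mu>t: "convolution_semigroup \<mu> \<mu>t"
    "\<And>B. B \<in> finite_borel \<Longrightarrow> distr P borel (\<Xi> B) = \<mu>t (measure lborel B)"
    using assms unfolding levy_noise_def by blast
  have fin: "\<forall>B\<in>finite_borel. \<Xi> B \<in> borel_measurable P"
    and seq: "\<And>(n::nat) (B :: nat \<Rightarrow> 'a set). B ` {..<n} \<subseteq> finite_borel \<Longrightarrow> disjoint_family_on B {..<n} \<Longrightarrow>
        indep_vars (\<lambda>_. borel) (\<lambda>i. \<Xi> (B i)) {..<n} \<and>
        (AE \<omega> in P. \<Xi> (\<Union>i<n. B i) \<omega> = (\<Sum>i<n. \<Xi> (B i) \<omega>))"
    using assms unfolding levy_noise_def by simp_all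
  have law: "\<forall>t\<ge>0. real_distribution (\<mu>t t)" "\<mu>t 1 = \<mu>" "\<mu>t 0 = return borel 0"
    and conv: "\<forall>s\<ge>0. \<forall>r. filterlim r (at_right s) sequentially \<longrightarrow> weak_conv_m (\<lambda>n. \<mu>t (r n)) (\<mu>t s)"
    using \<mu>t(1) unfolding convolution_semigroup_def by simp_all
  have "noise P \<mu>t \<Xi>"
  proof (intro noise.intro noise_axioms.intro)
    show "weak_conv_m (\<lambda>n. \<mu>t (r n)) (return borel 0)" if "filterlim r (at_right 0) sequentially" for r
      using conv[rule_format, of 0 r] that by (simp add: law)
    show "indep_vars (\<lambda>_. borel) (\<lambda>i. \<Xi> (B i)) {..<n}"
      if "B ` {..<n} \<subseteq> finite_borel" "disjoint_family_on B {..<n}" for B :: "nat \<Rightarrow> 'a set" and n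
      using seq[OF that] by simp
    show "AE \<omega> in P. \<Xi> (\<Union>i<n. B i) \<omega> = (\<Sum>i<n. \<Xi> (B i) \<omega>)"
      if "B ` {..<n} \<subseteq> finite_borel" "disjoint_family_on B {..<n}" for B :: "nat \<Rightarrow> 'a set" and n
      using seq[OF that] by simp
  qed (use prob_space_axioms fin \<mu>t(2) law in simp_all)
  then show ?thesis using law(2) by (rule that)
qed

theorem theorem1p1:
  fixes \<mu> :: "real measure"
    and P :: "'w measure"
    and \<Xi> :: "(real^'n) set \<Rightarrow> 'w \<Rightarrow> real"
    and G :: "(real^'n^'n) set"
  assumes "CARD('n) \<ge> 2"
    and "infinitely_divisible \<mu>"
    and "\<nexists>c. \<mu> = return borel c"
    and "prob_space P"
    and "levy_noise P \<mu> \<Xi>"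
    and "subgroup G unimodular_group"
    and "closedin (top_of_set (carrier unimodular_group)) G"
  shows "(\<forall>S \<in> invariant_sigma_field P \<Xi> ((\<lambda>A x. A *v x) ` G).
            measure P {\<omega> \<in> space P. noise_map \<Xi> \<omega> \<in> S} \<in> {0, 1})
         \<longleftrightarrow> \<not> compact G"
proof -
  obtain \<mu>t where "noise P \<mu>t \<Xi>" and \<mu>1: "\<mu>t 1 = \<mu>"
    using levy_noise_imp_noise[OF assms(5)] .
  then interpret noise P \<mu>t \<Xi> by simp
  note unimodular = subgroup_unimodularD(1)[OF assms(6)]
  show ?thesis
  proof
    assume zero_one: "\<forall>S \<in> invariant_sigma_field P \<Xi> ((\<lambda>A x. A *v x) ` G).
      prob {\<omega> \<in> space P. noise_map \<Xi> \<omega> \<in> S} \<in> {0, 1}"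
    show "\<not> compact G"
    proof
      assume "compact G"
      then obtain B :: "(real^'n) set" where B: "B \<in> finite_borel" "measure lborel B = 1"
        "\<And>A. A \<in> G \<Longrightarrow> (*v) A -` B = B"
        using invariant_set_of_compact_group[OF assms(6)] by blast
      \<comment> \<open>Volume 1 makes the law of the noise on \<open>B\<close> equal to
        \<open>\<mu>\<close>, which is not a point mass.\<close>
      have "\<exists>S\<in>invariant_sigma_field P \<Xi> ((\<lambda>A x. A *v x) ` G).
          prob {\<omega> \<in> space P. noise_map \<Xi> \<omega> \<in> S} \<notin> {0, 1}"
        using B assms(3) by (intro nontrivial_invariant_set[of B]) (auto simp: \<mu>1)
      with zero_one show False by blast
    qed
  next
    assume "\<not> compact G"
    moreover have "closed (carrier unimodular_group :: (real^'n^'n) set)"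
      using closed_unimodular by (simp add: unimodular_group_def)
    \<comment> \<open>Relative closedness becomes closedness among all matrices, so by Heine--Borel
      noncompact means unbounded.\<close>
    then have "closed G" by (rule closedin_closed_trans[OF assms(7)])
    ultimately have unbounded: "\<not> bounded G" by (simp add: compact_eq_bounded_closed)
    have "\<exists>A\<in>G. measure lborel (cball 0 (real n) \<inter> (*v) A -` cball 0 (real n)) < (1/2)^n" for n :: nat
      by (rule small_overlap[OF unbounded, of "real n" "(1/2)^n"]) auto
    then obtain A where A: "\<And>n. A n \<in> G"
      "\<And>n::nat. measure lborel (cball 0 (real n) \<inter> (*v) (A n) -` cball 0 (real n)) < (1/2)^n"
      by metis
    show "\<forall>S \<in> invariant_sigma_field P \<Xi> ((\<lambda>A x. A *v x) ` G).
      prob {\<omega> \<in> space P. noise_map \<Xi> \<omega> \<in> S} \<in> {0, 1}"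
    proof
      fix S assume S: "S \<in> invariant_sigma_field P \<Xi> ((\<lambda>A x. A *v x) ` G)"
      have pres: "preserves_lebesgue ((*v) (A n))" for n
        by (intro preserves_lebesgue_unimodular unimodular A)
      show "prob {\<omega> \<in> space P. noise_map \<Xi> \<omega> \<in> S} \<in> {0, 1}"
      proof (rule zero_one_of_summable_overlaps[where g = "\<lambda>n. (*v) (A n)"])
        show "S \<in> sets noise_space" using S by (simp add: invariant_sigma_field_def)
        show "AE \<omega> in P. noise_map \<Xi> \<omega> \<in> S \<longleftrightarrow> noise_shift ((*v) (A n)) (noise_map \<Xi> \<omega>) \<in> S" for n
          using A(1) by (intro AE_of_invariant_sigma_field[OF S] pres) auto
      qed (use pres A in auto)
    qed
  qed
qed

end
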